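(* Let $f_n$ be the index, in intersection order, of the first terminal chord of a uniformly random connected chord diagram with $n$ chords. Then $\mathbb E(f_n)\sim \dfrac{2n}{3}$ as $n\to\infty$.
   Context: A chord diagram with $n$ chords is a perfect matching of $\{1,\dots,2n\}$; each pair $\{a,b\}$ with $a<b$ is a chord. The root chord is the chord containing $1$. The oriented intersection graph has a vertex per chord and an edge from $\{a,b\}$ to $\{c,d\}$ whenever $a<c<b<d$. The diagram is connected if this graph is connected (as an undirected graph); a chord is terminal if its vertex has no outgoing edge. The intersection order of the chords of a connected diagram $C$ is defined recursively: the root chord is first; removing the root chord leaves connected components $C_1,\dots,C_s$ (each regarded as a connected chord diagram, endpoints relabeled order-preservingly) ordered by their smallest endpoint; then come all chords of $C_1$ in their intersection order, then those of $C_2$, etc. *)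

theory Defs
  imports "HOL-Probability.Probability" "HOL-Library.Landau_Symbols" "HOL-Library.Disjoint_Sets"
begin

type_synonym chord = "nat set"

definition chord_diagram :: "nat \<Rightarrow> chord set \<Rightarrow> bool" where
  "chord_diagram n C \<longleftrightarrow> partition_on {1..2 * n} C \<and> (\<forall>c\<in>C. card c = 2)"

text \<open>
  The notions below apply to an arbitrary finite set \<open>D\<close> of pairwise disjoint chords. They
  depend only on the relative order of the endpoints, so the order-preserving relabelling of a
  component as a chord diagram on \<open>{1..2*k}\<close> is never needed; the root chord of a component is
  the chord that contains its smallest endpoint (the one relabelled as \<open>1\<close>).
\<close>

definition intersection_graph :: "chord set \<Rightarrow> (chord \<times> chord) set" where
  "intersection_graph D =
     {(x, y). x \<in> D \<and> y \<in> D \<and> (\<exists>a b c d. x = {a, b} \<and> y = {c, d} \<and> a < c \<and> c < b \<and> b < d)}"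

definition linked :: "chord set \<Rightarrow> (chord \<times> chord) set" where
  "linked D = Restr ((intersection_graph D \<union> (intersection_graph D)\<inverse>)\<^sup>*) D"

definition diagram_components :: "chord set \<Rightarrow> chord set set" where
  "diagram_components D = D // linked D"

definition connected_diagram :: "chord set \<Rightarrow> bool" where
  "connected_diagram D \<longleftrightarrow> D \<noteq> {} \<and> (\<forall>x\<in>D. \<forall>y\<in>D. (x, y) \<in> linked D)"

definition terminal :: "chord set \<Rightarrow> chord \<Rightarrow> bool" where
  "terminal D x \<longleftrightarrow> x \<in> D \<and> (\<nexists>y. (x, y) \<in> intersection_graph D)"

definition smallest_endpoint :: "chord set \<Rightarrow> nat" where
  "smallest_endpoint D = Min (\<Union>D)"

definition root_chord :: "chord set \<Rightarrow> chord" where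
  "root_chord D = (THE x. x \<in> D \<and> smallest_endpoint D \<in> x)"

definition ordered_components :: "chord set \<Rightarrow> chord set list" where
  "ordered_components D =
     map (inv_into (diagram_components D) smallest_endpoint)
       (sorted_list_of_set (smallest_endpoint ` diagram_components D))"

lemma ordered_components_subset:
  assumes "finite D" "K \<in> set (ordered_components D)"
  shows "K \<subseteq> D"
proof -
  have fin: "finite (diagram_components D)"
    unfolding diagram_components_def linked_def
    by (rule finite_quotient[OF assms(1)]) auto
  obtain m where "m \<in> smallest_endpoint ` diagram_components D"
      "K = inv_into (diagram_components D) smallest_endpoint m"
    using assms(2) fin by (auto simp: ordered_components_def)
  then have "K \<in> diagram_components D" by (simp add: inv_into_into)
  then show ?thesis by (auto simp: diagram_components_def linked_def quotient_def)
qed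

text \<open>
  The guard only serves totality: for a nonempty finite set of disjoint chords it always holds.
\<close>

function intersection_order :: "chord set \<Rightarrow> chord list" where
  "intersection_order D =
     (if finite D \<and> root_chord D \<in> D
      then root_chord D #
        concat (map intersection_order (ordered_components (D - {root_chord D})))
      else [])"
  by auto
termination
proof (relation "Wellfounded.measure card")
  fix D K :: "chord set"
  assume D: "finite D \<and> root_chord D \<in> D"
    and "K \<in> set (ordered_components (D - {root_chord D}))"
  then have "K \<subseteq> D - {root_chord D}" by (intro ordered_components_subset) auto
  then have "K \<subset> D" using D by blast
  then show "(K, D) \<in> Wellfounded.measure card" using D by (simp add: psubset_card_mono)
qed simp

declare intersection_order.simps [simp del]

definition first_terminal_index :: "chord set \<Rightarrow> nat" where
  "first_terminal_index C =
     (LEAST i. 1 \<le> i \<and> i \<le> length (intersection_order C) \<and>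
               terminal C (intersection_order C ! (i - 1)))"

definition connected_chord_diagrams :: "nat \<Rightarrow> chord set set" where
  "connected_chord_diagrams n = {C. chord_diagram n C \<and> connected_diagram C}"

end

(*
  Let C be a connected diagram with n >= 2 chords and K the first component left by removing its
  root chord {m, b}. Every other component lies in the gap of K that contains b. Hence C is given by
  K, one of the 2k - 1 inner gaps of K (k = number of chords of K), and the connected diagram
  formed by the root chord and the remaining components. So the numbers c_n of connected diagrams
  satisfy c_n = sum_k (2k - 1) c_k c_(n-k), and conditionally on its size, K is uniformly distributed.
  The root chord of C is not terminal, and a chord of K is terminal in C iff it is terminal in K,
  so the index of the first terminal chord of C is one more than that of K.

  Thus the mean F_n satisfies F_n = 1 + E(F_k) with k the random size of K, and F_n ~ n / E(n - k)
  follows once E(n - k) converges. Its limit is 3/2: jumps to k = n - 1, k = n - 2 and k = 1 have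
  probabilities about 1 - 1/n, 1/(2n) and 1/(2n), and the other sizes are negligible. The
  estimates rest on c_n <= 2^n n!/8 (n >= 2), on c_n >= 2(n-1) c_(n-1) (n >= 3), and on the symmetry k <-> n - k.
*)

theory Submission
  imports Defs "HOL-Real_Asymp.Real_Asymp"
begin

section \<open>Crossing chords and connectedness\<close>

text \<open>The limit 3/2 is more than the typical drop by 1: the jump to k = 1, though of
  probability only about 1/(2n), removes n - 1 chords at once and so adds 1/2. Hence it is not
  enough that the other sizes are improbable; their share has to vanish even after multiplication by
  n - k. No asymptotic formula for c_n enters. In c_k c_(n-k) / c_n one factor of the numerator is
  bounded absolutely and the other relative to c_n, so the true size of c_n cancels. The other
  components fall into the gap of b because a chord outside K, other than the root, passes over no
  endpoint of K: K is connected and contains the least endpoint left by the root. Following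
  crossings from the root therefore never leads out of that gap.\<close>

definition crossing :: "chord \<Rightarrow> chord \<Rightarrow> bool" where
  "crossing x y \<longleftrightarrow> (x, y) \<in> intersection_graph UNIV \<or> (y, x) \<in> intersection_graph UNIV"

definition chords :: "chord set \<Rightarrow> bool" where
  "chords D \<longleftrightarrow> finite D \<and> disjoint D \<and> (\<forall>c\<in>D. card c = 2)"

lemma crossing_commute: "crossing x y \<longleftrightarrow> crossing y x"
  by (auto simp: crossing_def)

lemma crossing_doubletons:
  assumes "a < b" "c < d"
  shows "crossing {a, b} {c, d} \<longleftrightarrow> a < c \<and> c < b \<and> b < d \<or> c < a \<and> a < d \<and> d < b"
proof -
  have *: "({a, b}, {c, d}) \<in> intersection_graph UNIV \<longleftrightarrow> a < c \<and> c < b \<and> b < d"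
    if "a < b" "c < d" for a b c d
  proof
    assume "({a, b}, {c, d}) \<in> intersection_graph UNIV"
    then show "a < c \<and> c < b \<and> b < d"
      using that by (auto simp: intersection_graph_def doubleton_eq_iff)
  qed (auto simp: intersection_graph_def)
  show ?thesis
    using assms by (simp add: crossing_def *)
qed

lemma card_2_less_obtain:
  fixes x :: chord
  assumes "card x = 2"
  obtains a b where "x = {a, b}" "a < b"
  using assms by (metis card_2_iff insert_commute linorder_neqE_nat)

lemma chords_obtain:
  assumes "chords D" "x \<in> D"
  obtains a b where "x = {a, b}" "a < b"
  using assms card_2_less_obtain[of x] unfolding chords_def by blast

lemma chords_subset: "chords D \<Longrightarrow> E \<subseteq> D \<Longrightarrow> chords E"
  by (auto simp: chords_def intro: finite_subset pairwise_subset)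

lemma chords_unique:
  assumes "chords D" "x \<in> D" "y \<in> D" "t \<in> x" "t \<in> y"
  shows "x = y"
  using assms by (auto simp: chords_def disjoint_def)

lemma chords_finite_Union: "chords D \<Longrightarrow> finite (\<Union>D)"
  unfolding chords_def by (metis card.infinite finite_Union zero_neq_numeral)

lemma chords_card_Union:
  assumes "chords D"
  shows "card (\<Union>D) = 2 * card D"
proof -
  have "card (\<Union>D) = sum card D"
    using assms chords_finite_Union[OF assms]
    by (intro card_Union_disjoint) (auto simp: chords_def intro: finite_subset)
  then show ?thesis using assms by (simp add: chords_def)
qed

lemma crossing_step:
  "(x, y) \<in> intersection_graph D \<union> (intersection_graph D)\<inverse> \<longleftrightarrow> x \<in> D \<and> y \<in> D \<and> crossing x y"
  by (auto simp: crossing_def intersection_graph_def)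

text \<open>Q need not be a subset of D, so a geometric condition on chords can serve as Q
  directly.\<close>

definition crossing_closed :: "chord set \<Rightarrow> chord set \<Rightarrow> bool" where
  "crossing_closed D Q \<longleftrightarrow> (\<forall>u\<in>D \<inter> Q. \<forall>v\<in>D. crossing u v \<longrightarrow> v \<in> Q)"

lemma linked_step:
  assumes "(x, u) \<in> linked D" "v \<in> D" "crossing u v"
  shows "(x, v) \<in> linked D"
proof -
  have "u \<in> D" using assms(1) by (simp add: linked_def)
  then have "(u, v) \<in> intersection_graph D \<union> (intersection_graph D)\<inverse>"
    using assms crossing_step by blast
  then show ?thesis
    using assms(1,2) unfolding linked_def by (blast intro: rtrancl_into_rtrancl)
qed

lemma linked_crossing_closed:
  assumes "crossing_closed D Q" "(x, y) \<in> linked D" "x \<in> Q"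
  shows "y \<in> Q"
proof -
  have "(x, y) \<in> (intersection_graph D \<union> (intersection_graph D)\<inverse>)\<^sup>*"
    using assms(2) by (simp add: linked_def)
  then show ?thesis
  proof induction
    case (step y z)
    then show ?case
      using assms(1) by (auto simp only: crossing_step crossing_closed_def)
  qed (fact assms)
qed

lemma equiv_linked: "equiv D (linked D)"
proof (rule equivI)
  have "sym ((intersection_graph D \<union> (intersection_graph D)\<inverse>)\<^sup>*)"
    by (intro sym_rtrancl sym_Un_converse)
  then show "sym (linked D)" by (auto simp: linked_def sym_def)
  show "trans (linked D)"
    unfolding linked_def by (rule trans_Restr) (rule trans_rtrancl)
qed (auto simp: linked_def refl_on_def)

text \<open>Connectedness as an induction principle: a property that holds for one chord r and
  passes along crossings holds for all of D. Conversely, the class of r is itself such a Q.\<close>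

lemma connected_diagram_iff:
  assumes "r \<in> D"
  shows "connected_diagram D \<longleftrightarrow> (\<forall>Q. r \<in> Q \<longrightarrow> crossing_closed D Q \<longrightarrow> D \<subseteq> Q)"
proof
  assume "connected_diagram D"
  then show "\<forall>Q. r \<in> Q \<longrightarrow> crossing_closed D Q \<longrightarrow> D \<subseteq> Q"
    using assms linked_crossing_closed by (fastforce simp: connected_diagram_def)
next
  assume *: "\<forall>Q. r \<in> Q \<longrightarrow> crossing_closed D Q \<longrightarrow> D \<subseteq> Q"
  have "crossing_closed D (linked D `` {r})"
    by (auto simp: crossing_closed_def intro: linked_step)
  moreover have "r \<in> linked D `` {r}"
    using assms by (auto simp: linked_def)
  ultimately have "D \<subseteq> linked D `` {r}"
    using * by blast
  then have "\<forall>x\<in>D. (r, x) \<in> linked D"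
    by blast
  then show "connected_diagram D"
    using assms equiv_linked[of D] unfolding connected_diagram_def
    by (meson empty_iff equivE symD transD)
qed

lemma connected_diagramD:
  assumes "connected_diagram D" "r \<in> D" "r \<in> Q" "crossing_closed D Q"
  shows "D \<subseteq> Q"
  using assms connected_diagram_iff by blast

lemma diagram_components_iff:
  "K \<in> diagram_components E \<longleftrightarrow> K \<subseteq> E \<and> connected_diagram K \<and> crossing_closed E K"
proof
  assume "K \<in> diagram_components E"
  then obtain x where x: "x \<in> E" and K: "K = linked E `` {x}"
    by (auto simp: diagram_components_def elim: quotientE)
  have sub: "K \<subseteq> E" using K by (auto simp: linked_def)
  have cl: "crossing_closed E K"
    using K by (auto simp: crossing_closed_def intro: linked_step)
  have xK: "x \<in> K" using K x by (auto simp: linked_def)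
  have "K \<subseteq> Q" if "x \<in> Q" "crossing_closed K Q" for Q
  proof
    fix y assume "y \<in> K"
    \<comment> \<open>Q is closed only within K; cut down to K, which is closed in E, it becomes
      closed in E.\<close>
    have "crossing_closed E (K \<inter> Q)"
      using cl that(2) sub unfolding crossing_closed_def by blast
    then show "y \<in> Q"
      using linked_crossing_closed[of E "K \<inter> Q" x y] \<open>y \<in> K\<close> K xK that(1) by blast
  qed
  then show "K \<subseteq> E \<and> connected_diagram K \<and> crossing_closed E K"
    using sub cl connected_diagram_iff[OF xK] by blast
next
  assume K: "K \<subseteq> E \<and> connected_diagram K \<and> crossing_closed E K"
  then obtain x where x: "x \<in> K" by (auto simp: connected_diagram_def)
  have "linked E `` {x} \<subseteq> K"
    using linked_crossing_closed K x by blast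
  moreover have "K \<subseteq> linked E `` {x}"
  proof (rule connected_diagramD[of K x])
    show "x \<in> linked E `` {x}" using x K by (auto simp: linked_def)
    show "crossing_closed K (linked E `` {x})"
      using K unfolding crossing_closed_def by (auto intro: linked_step)
  qed (use K x in auto)
  ultimately have "K = linked E `` {x}" by blast
  then show "K \<in> diagram_components E"
    using x K by (auto simp: diagram_components_def intro: quotientI)
qed

text \<open>Each chord of D lies wholly inside or wholly outside the interval from p to q. A chord
  outside cannot cross one inside, since it would need an endpoint between the two ends of the inner
  chord. So all of D stays on the side of t.\<close>

lemma noncrossing_connected_outside:
  assumes "chords D" "connected_diagram D" "p < q" "t \<in> \<Union>D" "\<not> (p < t \<and> t < q)"
    and nc: "\<And>w. w \<in> D \<Longrightarrow> \<not> crossing w {p, q} \<and> p \<notin> w \<and> q \<notin> w"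
    and "s \<in> \<Union>D"
  shows "\<not> (p < s \<and> s < q)"
proof -
  have both: "(\<forall>t\<in>w. p < t \<and> t < q) \<or> (\<forall>t\<in>w. \<not> (p < t \<and> t < q))" if w: "w \<in> D" for w
  proof -
    obtain a b where ab: "w = {a, b}" "a < b"
      using w chords_obtain[OF assms(1)] by blast
    show ?thesis
      using nc[OF w] crossing_doubletons[OF ab(2) assms(3)] ab by auto
  qed
  obtain x where x: "x \<in> D" "t \<in> x" using assms(4) by auto
  let ?Q = "{w. \<forall>t\<in>w. \<not> (p < t \<and> t < q)}"
  have "D \<subseteq> ?Q"
  proof (rule connected_diagramD[OF assms(2) x(1)])
    show "x \<in> ?Q" using both[OF x(1)] x(2) assms(5) by auto
    show "crossing_closed D ?Q"
      unfolding crossing_closed_def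
    proof (intro ballI impI)
      fix u v assume uv: "u \<in> D \<inter> ?Q" "v \<in> D" "crossing u v"
      obtain a b where ab: "u = {a, b}" "a < b"
        using uv(1) chords_obtain[OF assms(1)] by blast
      obtain c d where cd: "v = {c, d}" "c < d"
        using uv(2) chords_obtain[OF assms(1)] by blast
      have "a < c \<and> c < b \<and> b < d \<or> c < a \<and> a < d \<and> d < b"
        using uv(3) crossing_doubletons[OF ab(2) cd(2)] ab cd by simp
      moreover have "\<not> (p < a \<and> a < q)" "\<not> (p < b \<and> b < q)"
        using uv(1) ab by auto
      ultimately have "\<not> (p < c \<and> c < q \<and> p < d \<and> d < q)"
        by linarith
      then show "v \<in> ?Q"
        using both[OF uv(2)] cd by blast
    qed
  qed
  then show ?thesis using assms(7) by blast
qed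

text \<open>If no chord passed over b, each chord would lie on one side of b, and chords on
  different sides do not cross.\<close>

lemma connected_straddling_chord:
  assumes "chords D" "connected_diagram D" "s \<in> \<Union>D" "t \<in> \<Union>D" "s < b" "b < t" "b \<notin> \<Union>D"
  obtains p q where "{p, q} \<in> D" "p < b" "b < q"
proof (rule ccontr)
  assume "\<not> thesis"
  with that have no: "\<not> (p < b \<and> b < q)" if "{p, q} \<in> D" for p q
    using \<open>{p, q} \<in> D\<close> by blast
  obtain x where x: "x \<in> D" "s \<in> x" using assms(3) by auto
  have both: "(\<forall>t\<in>w. t < b) \<or> (\<forall>t\<in>w. b < t)" if w: "w \<in> D" for w
  proof -
    obtain a c where ac: "w = {a, c}" "a < c"
      using w chords_obtain[OF assms(1)] by blast
    have "b \<noteq> a" "b \<noteq> c" using ac w assms(7) by auto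
    then show ?thesis using no[of a c] w ac by auto
  qed
  let ?Q = "{w. \<forall>t\<in>w. t < b}"
  have "D \<subseteq> ?Q"
  proof (rule connected_diagramD[OF assms(2) x(1)])
    show "x \<in> ?Q" using both[OF x(1)] x(2) assms(5) by auto
    show "crossing_closed D ?Q"
      unfolding crossing_closed_def
    proof (intro ballI impI)
      fix u v assume uv: "u \<in> D \<inter> ?Q" "v \<in> D" "crossing u v"
      obtain a c where ab: "u = {a, c}" "a < c"
        using uv(1) chords_obtain[OF assms(1)] by blast
      obtain d e where cd: "v = {d, e}" "d < e"
        using uv(2) chords_obtain[OF assms(1)] by blast
      have "a < d \<and> d < c \<and> c < e \<or> d < a \<and> a < e \<and> e < c"
        using uv(3) crossing_doubletons[OF ab(2) cd(2)] ab cd by simp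
      moreover have "a < b" "c < b"
        using uv(1) ab by auto
      ultimately have "\<not> (b < d \<and> b < e)"
        by linarith
      then show "v \<in> ?Q"
        using both[OF uv(2)] cd by blast
    qed
  qed
  moreover obtain y where "y \<in> D" "t \<in> y" using assms(4) by auto
  ultimately have "t < b" by blast
  then show False using assms(6) by simp
qed

section \<open>The root decomposition\<close>

definition connected_diagrams_on :: "nat set \<Rightarrow> chord set set" where
  "connected_diagrams_on S = {D. chords D \<and> \<Union>D = S \<and> connected_diagram D}"

lemma connected_chord_diagrams_eq:
  "connected_chord_diagrams n = connected_diagrams_on {1..2 * n}"
proof -
  have "chord_diagram n D \<longleftrightarrow> chords D \<and> \<Union>D = {1..2 * n}" for D
  proof
    assume "chord_diagram n D"
    then show "chords D \<and> \<Union>D = {1..2 * n}"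
      using finite_elements[of "{1..2 * n}" D]
      by (auto simp: chord_diagram_def chords_def partition_on_def)
  next
    assume "chords D \<and> \<Union>D = {1..2 * n}"
    then show "chord_diagram n D"
      by (auto simp: chord_diagram_def chords_def partition_on_def)
  qed
  then show ?thesis
    by (auto simp: connected_chord_diagrams_def connected_diagrams_on_def)
qed

lemma finite_connected_diagrams_on:
  assumes "finite S"
  shows "finite (connected_diagrams_on S)"
proof (rule finite_subset)
  show "connected_diagrams_on S \<subseteq> Pow (Pow S)"
    by (auto simp: connected_diagrams_on_def)
qed (use assms in auto)

section \<open>Smallest endpoints and the head of the component list\<close>

lemma root_chord_eq:
  assumes "chords D" "x \<in> D" "Min (\<Union>D) \<in> x"
  shows "root_chord D = x"
  unfolding root_chord_def smallest_endpoint_def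
  using assms chords_unique[OF assms(1)] by (intro the_equality) auto

text \<open>Distinct components share no endpoint, so their smallest endpoints differ and
  \<open>inv_into\<close> recovers a component from its minimum. The component holding the least
  endpoint of E then comes first.\<close>

lemma ordered_components_Cons:
  assumes "chords E" "K \<in> diagram_components E" "Min (\<Union>E) \<in> \<Union>K"
  obtains Ks where "ordered_components E = K # Ks"
proof -
  let ?C = "diagram_components E"
  have finE: "finite (\<Union>E)" using assms(1) by (rule chords_finite_Union)
  have fin: "finite ?C"
    using assms(1) unfolding diagram_components_def chords_def linked_def
    by (intro finite_quotient) auto
  have sub: "L \<subseteq> E" "\<Union>L \<noteq> {}" if "L \<in> ?C" for L
  proof -
    show "L \<subseteq> E" using that by (simp add: diagram_components_iff)
    moreover have "L \<noteq> {}"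
      using that by (auto simp: diagram_components_iff connected_diagram_def)
    ultimately show "\<Union>L \<noteq> {}"
      using assms(1) by (fastforce simp: chords_def)
  qed
  have finL: "finite (\<Union>L)" if "L \<in> ?C" for L
    using finite_subset[OF Union_mono[OF sub(1)[OF that]] finE] .
  have mem: "smallest_endpoint L \<in> \<Union>L" if "L \<in> ?C" for L
    unfolding smallest_endpoint_def using Min_in[OF finL[OF that] sub(2)[OF that]] .
  have inj: "inj_on smallest_endpoint ?C"
  proof (rule inj_onI)
    fix L M assume LM: "L \<in> ?C" "M \<in> ?C" "smallest_endpoint L = smallest_endpoint M"
    obtain x y where "x \<in> L" "y \<in> M" "smallest_endpoint L \<in> x" "smallest_endpoint L \<in> y"
      using mem[OF LM(1)] mem[OF LM(2)] LM(3) by auto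
    moreover from this have "x = y"
      using chords_unique[OF assms(1)] sub(1) LM by blast
    ultimately show "L = M"
      using quotient_disj[OF equiv_linked, of L E M] LM by (auto simp: diagram_components_def)
  qed
  have ge: "Min (\<Union>E) \<le> smallest_endpoint L" if "L \<in> ?C" for L
    using mem[OF that] sub(1)[OF that] finE by (intro Min_le) auto
  have "smallest_endpoint K \<le> Min (\<Union>E)"
    unfolding smallest_endpoint_def using assms finL by (intro Min_le) auto
  with ge[OF assms(2)] have K: "smallest_endpoint K = Min (\<Union>E)" by simp
  let ?M = "smallest_endpoint ` ?C"
  have ne: "?M \<noteq> {}" "finite ?M" using assms(2) fin by auto
  have "Min ?M = Min (\<Union>E)"
    using fin assms(2) K ge by (intro Min_eqI) (auto simp: image_iff intro: bexI[of _ K])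
  then have "sorted_list_of_set ?M = Min (\<Union>E) # sorted_list_of_set (?M - {Min (\<Union>E)})"
    using sorted_list_of_set_nonempty[OF ne(2,1)] by simp
  moreover have "inv_into ?C smallest_endpoint (Min (\<Union>E)) = K"
    using inv_into_f_f[OF inj assms(2)] K by simp
  ultimately show ?thesis
    using that unfolding ordered_components_def by simp
qed

lemma set_intersection_order: "set (intersection_order D) \<subseteq> D"
proof (induction D rule: intersection_order.induct)
  case (1 D)
  show ?case
  proof (cases "finite D \<and> root_chord D \<in> D")
    case True
    have "set (intersection_order K) \<subseteq> D"
      if "K \<in> set (ordered_components (D - {root_chord D}))" for K
      using "1.IH"[OF True that] ordered_components_subset[of "D - {root_chord D}" K] that True by auto
    then show ?thesis
      using True by (subst intersection_order.simps) auto
  qed (subst intersection_order.simps, auto)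
qed

text \<open>A \<open>LEAST\<close> over an empty predicate says nothing, so the existence of a
  terminal chord in the list is carried through the induction along with the index.\<close>

definition has_terminal_chord :: "chord set \<Rightarrow> bool" where
  "has_terminal_chord D \<longleftrightarrow>
     (\<exists>i < length (intersection_order D). terminal D (intersection_order D ! i))"

lemma first_terminal_index_eq_Least:
  assumes "has_terminal_chord D"
  shows "first_terminal_index D =
    Suc (LEAST i. i < length (intersection_order D) \<and> terminal D (intersection_order D ! i))"
proof -
  let ?P = "\<lambda>i. 1 \<le> i \<and> i \<le> length (intersection_order D) \<and>
               terminal D (intersection_order D ! (i - 1))"
  obtain i where "?P (Suc i)"
    using assms by (auto simp: has_terminal_chord_def Suc_le_eq)
  then have "(LEAST i. ?P i) = Suc (LEAST i. ?P (Suc i))"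
    by (rule Least_Suc) simp
  then show ?thesis by (simp add: first_terminal_index_def Suc_le_eq)
qed

section \<open>Passing the first terminal chord from K to D\<close>

text \<open>
  The decomposition of a connected diagram \<open>D\<close> into the first component \<open>K\<close> left by the removal
  of the root chord \<open>r = {m, b}\<close>, and the remaining diagram \<open>R\<close>, which still contains \<open>r\<close>.
\<close>

locale root_decomposition =
  fixes D K R :: "chord set" and m b :: nat
  assumes chords: "chords D"
    and union: "D = K \<union> R" and disjnt: "K \<inter> R = {}"
    and root: "{m, b} \<in> R" and m_less: "\<And>t. t \<in> \<Union>D \<Longrightarrow> t \<noteq> m \<Longrightarrow> m < t"
    and connected: "connected_diagram K"
    and separated: "\<And>u v. u \<in> K \<Longrightarrow> v \<in> R \<Longrightarrow> v \<noteq> {m, b} \<Longrightarrow> \<not> crossing u v"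
    and straddle: "\<exists>p q. {p, q} \<in> K \<and> p < b \<and> b < q"
    and least: "Min (\<Union>(D - {{m, b}})) \<in> \<Union>K"
begin

lemma root_mem: "{m, b} \<in> D" "{m, b} \<notin> K"
  using root union disjnt by auto

lemma Min_eq: "Min (\<Union>D) = m"
  using m_less root_mem(1) chords_finite_Union[OF chords]
  by (intro Min_eqI) (auto simp: order.order_iff_strict)

lemma root_chord: "root_chord D = {m, b}"
  by (rule root_chord_eq[OF chords root_mem(1)]) (simp add: Min_eq)

lemma component: "K \<in> diagram_components (D - {{m, b}})"
  using union disjnt root_mem connected separated
  by (auto simp: diagram_components_iff crossing_closed_def)

text \<open>The tail \<open>xs\<close> lists the chords after those of K. It can stay abstract: the
  first terminal chord is already met in the segment of K.\<close>

lemma intersection_order_append: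
  obtains xs where "intersection_order D = {m, b} # intersection_order K @ xs"
proof -
  have "chords (D - {{m, b}})" using chords by (rule chords_subset) auto
  then obtain Ks where "ordered_components (D - {{m, b}}) = K # Ks"
    using ordered_components_Cons component least by blast
  then show ?thesis
    using that root_mem(1) chords
    by (subst (asm) intersection_order.simps) (simp add: root_chord chords_def)
qed

lemma m_less_b: "m < b"
proof -
  have "m \<noteq> b"
  proof
    assume "m = b"
    then have "card {m, b} = 1" by simp
    then show False using chords root_mem(1) by (simp add: chords_def)
  qed
  then show ?thesis using m_less[of b] root_mem(1) by auto
qed

lemma root_edge: "\<exists>w\<in>K. ({m, b}, w) \<in> intersection_graph D"
proof -
  obtain p q where pq: "{p, q} \<in> K" "p < b" "b < q" using straddle by blast
  then have "p \<noteq> m"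
    using union root_mem chords_unique[OF chords, of "{p, q}" "{m, b}" p] by auto
  moreover have "p \<in> \<Union>D"
    using pq union by auto
  ultimately have "m < p"
    using m_less by blast
  then have "({m, b}, {p, q}) \<in> intersection_graph D"
    using pq union root_mem(1) unfolding intersection_graph_def by blast
  then show ?thesis using pq(1) by blast
qed

lemma not_terminal_root: "\<not> terminal D {m, b}"
  using root_edge by (auto simp: terminal_def)

text \<open>Only the root crosses K from outside, and such an edge starts at the root, whose left
  end is the least endpoint of all. So it is never an outgoing edge of a chord of K.\<close>

lemma terminal_component:
  assumes "x \<in> K"
  shows "terminal D x \<longleftrightarrow> terminal K x"
proof -
  have "(x, y) \<in> intersection_graph D \<longleftrightarrow> (x, y) \<in> intersection_graph K" for y
  proof
    assume xy: "(x, y) \<in> intersection_graph D"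
    then have cr: "crossing x y"
      by (auto simp: crossing_def intersection_graph_def)
    have "y \<noteq> {m, b}"
    proof
      assume "y = {m, b}"
      then obtain a c d e where *: "x = {a, c}" "{m, b} = {d, e}" "a < d" "d < c" "c < e"
        using xy by (auto simp: intersection_graph_def)
      then have "m = d" using m_less_b by (auto simp: doubleton_eq_iff)
      then show False using * m_less[of a] assms union by auto
    qed
    then have "y \<in> K"
      using separated[of x y] assms cr xy union by (auto simp: intersection_graph_def)
    then show "(x, y) \<in> intersection_graph K"
      using xy assms by (auto simp: intersection_graph_def)
  qed (use union in \<open>auto simp: intersection_graph_def\<close>)
  then show ?thesis using assms union by (auto simp: terminal_def)
qed

lemma component_eq: "K = hd (ordered_components (D - {root_chord D}))"
proof -
  have "chords (D - {{m, b}})" using chords by (rule chords_subset) auto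
  then obtain Ks where "ordered_components (D - {{m, b}}) = K # Ks"
    using ordered_components_Cons component least by blast
  then show ?thesis by (simp add: root_chord)
qed

lemma first_terminal_index_Suc:
  assumes "has_terminal_chord K"
  shows "has_terminal_chord D" "first_terminal_index D = Suc (first_terminal_index K)"
proof -
  obtain xs where xs: "intersection_order D = {m, b} # intersection_order K @ xs"
    by (rule intersection_order_append)
  define A where "A L i \<longleftrightarrow> i < length (intersection_order L) \<and> terminal L (intersection_order L ! i)"
    for L i
  have AK: "A D (Suc i) \<longleftrightarrow> A K i" if "i < length (intersection_order K)" for i
  proof -
    have "intersection_order K ! i \<in> K"
      using that set_intersection_order[of K] nth_mem by blast
    then show ?thesis
      using that by (simp add: A_def xs nth_append terminal_component)
  qed
  obtain i where i: "A K i"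
    using assms by (auto simp: A_def has_terminal_chord_def)
  then have Di: "A D (Suc i)" using AK by (simp add: A_def)
  then show hD: "has_terminal_chord D"
    unfolding has_terminal_chord_def A_def by blast
  have "\<not> A D 0" using not_terminal_root by (simp add: A_def xs)
  then have "(LEAST i. A D i) = Suc (LEAST i. A D (Suc i))"
    using Di by (intro Least_Suc)
  also have "(LEAST i. A D (Suc i)) = (LEAST i. A K i)"
  proof (rule Least_equality)
    have "A K (LEAST i. A K i)" using i by (rule LeastI)
    then show "A D (Suc (LEAST i. A K i))" using AK by (simp add: A_def)
  next
    fix j assume j: "A D (Suc j)"
    show "(LEAST i. A K i) \<le> j"
    proof (cases "j < length (intersection_order K)")
      case True
      then show ?thesis using j AK by (auto intro: Least_le)
    next
      \<comment> \<open>The witness \<open>i\<close> lies inside the segment of K, hence before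
        \<open>j\<close>.\<close>
      case False
      moreover have "(LEAST i. A K i) \<le> i" using i by (rule Least_le)
      ultimately show ?thesis using i by (simp add: A_def)
    qed
  qed
  finally show "first_terminal_index D = Suc (first_terminal_index K)"
    using first_terminal_index_eq_Least[OF assms] first_terminal_index_eq_Least[OF hD]
    by (simp add: A_def)
qed

end

text \<open>I is to hold the endpoints of R other than the minimum m, and T = S - {m} - I those of
  K. The condition says that I fills one gap of T with points of T on both sides; by the last clause
  no point of T separates two points of I.\<close>

definition inner_interval :: "nat set \<Rightarrow> nat set \<Rightarrow> bool" where
  "inner_interval S I \<longleftrightarrow> I \<noteq> {} \<and> I \<subseteq> S - {Min S} \<and>
     (\<exists>p\<in>S - {Min S} - I. \<exists>q\<in>S - {Min S} - I. \<forall>x\<in>I. p < x \<and> x < q) \<and>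
     (\<forall>t\<in>S - {Min S} - I. \<forall>x\<in>I. \<forall>y\<in>I. t < x \<longrightarrow> t < y)"

text \<open>The partner of m lies in an inner gap of K, so a chord of the connected K passes over it
  and crosses the root; this links K to R. The other chords of R have both ends in a single gap of K
  and cross no chord of K.\<close>

lemma inner_interval_compose:
  assumes "finite S" "inner_interval S I"
    and K: "K \<in> connected_diagrams_on (S - {Min S} - I)"
    and R: "R \<in> connected_diagrams_on (insert (Min S) I)"
  shows "K \<union> R \<in> connected_diagrams_on S" "\<exists>b. root_decomposition (K \<union> R) K R (Min S) b"
proof -
  define m where "m = Min S"
  define T where "T = S - {m} - I"
  have I: "I \<noteq> {}" "I \<subseteq> S - {m}" and conv: "\<And>t x y. t \<in> T \<Longrightarrow> x \<in> I \<Longrightarrow> y \<in> I \<Longrightarrow> t < x \<Longrightarrow> t < y"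
    using assms(2) by (auto simp: inner_interval_def m_def T_def)
  obtain p q where pq: "p \<in> T" "q \<in> T" "\<And>x. x \<in> I \<Longrightarrow> p < x \<and> x < q"
    using assms(2) unfolding inner_interval_def m_def T_def by blast
  have KT: "\<Union>K = T" and RI: "\<Union>R = insert m I" and chK: "chords K" and chR: "chords R"
    and coK: "connected_diagram K" and coR: "connected_diagram R"
    using K R by (auto simp: connected_diagrams_on_def m_def T_def)
  have mS: "m \<in> S" using I assms(1) unfolding m_def by (intro Min_in) auto
  have m_less: "m < t" if "t \<in> S" "t \<noteq> m" for t
    using that assms(1) unfolding m_def by (metis Min_le le_neq_trans)
  obtain r where r: "r \<in> R" "m \<in> r" using RI by auto
  obtain a c where ac: "r = {a, c}" "a < c" using chords_obtain[OF chR r(1)] .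
  have acI: "a \<in> insert m I" "c \<in> insert m I" using RI r(1) ac(1) by auto
  have "a = m"
  proof (rule ccontr)
    assume "a \<noteq> m"
    then have "c = m" using r(2) ac(1) by auto
    then show False using m_less[of a] acI(1) \<open>a \<noteq> m\<close> I(2) ac(2) by auto
  qed
  then have rc: "r = {m, c}" and cI: "c \<in> I" using ac acI by auto
  have disj: "x \<inter> y = {}" if "x \<in> K" "y \<in> R" for x y
  proof -
    have "x \<subseteq> T" "y \<subseteq> insert m I" using that KT RI by auto
    then show ?thesis unfolding T_def by auto
  qed
  have ne: "x \<noteq> {}" if "x \<in> K" for x
    using that chK by (auto simp: chords_def)
  have "K \<inter> R = {}"
    using disj ne by blast
  have ch: "chords (K \<union> R)"
  proof -
    have "x \<inter> y = {}" if "x \<in> K \<union> R" "y \<in> K \<union> R" "x \<noteq> y" for x y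
      using that disj[of x y] disj[of y x] chords_unique[OF chK, of x y] chords_unique[OF chR, of x y]
      by blast
    then have "disjoint (K \<union> R)" by (simp only: disjoint_def) blast
    moreover have "finite (K \<union> R)" "\<forall>c\<in>K \<union> R. card c = 2"
      using chK chR by (auto simp: chords_def)
    ultimately show ?thesis by (simp only: chords_def)
  qed
  have un: "\<Union>(K \<union> R) = S"
    using KT RI mS I by (auto simp: T_def)
  obtain s t where st: "{s, t} \<in> K" "s < c" "c < t"
    using connected_straddling_chord[OF chK coK, of p q c] pq KT cI unfolding T_def by auto
  have sep: "\<not> crossing u v" if uv: "u \<in> K" "v \<in> R" "v \<noteq> {m, c}" for u v
  proof
    assume cr: "crossing u v"
    obtain a1 a2 where a: "u = {a1, a2}" "a1 < a2" using chords_obtain[OF chK uv(1)] .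
    obtain b1 b2 where b: "v = {b1, b2}" "b1 < b2" using chords_obtain[OF chR uv(2)] .
    have "m \<notin> v" using chords_unique[OF chR uv(2) r(1), of m] rc uv(3) r(2) by auto
    then have "b1 \<in> I" "b2 \<in> I" using RI uv(2) b by auto
    moreover have "a1 \<in> T" "a2 \<in> T" using KT uv(1) a by auto
    moreover have "a1 < b1 \<and> b1 < a2 \<and> a2 < b2 \<or> b1 < a1 \<and> a1 < b2 \<and> b2 < a2"
      using cr crossing_doubletons[OF a(2) b(2)] a b by simp
    ultimately show False using conv by (meson less_asym)
  qed
  have cr: "crossing r {s, t}"
  proof -
    have "s \<in> T" using st(1) KT by auto
    then have "m < s" using m_less by (auto simp: T_def)
    then have "crossing {m, c} {s, t}" using st by (subst crossing_doubletons) auto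
    then show ?thesis using rc by simp
  qed
  have "connected_diagram (K \<union> R)"
  proof (subst connected_diagram_iff)
    show "r \<in> K \<union> R" using r by auto
    show "\<forall>Q. r \<in> Q \<longrightarrow> crossing_closed (K \<union> R) Q \<longrightarrow> K \<union> R \<subseteq> Q"
    proof (intro allI impI)
      fix Q assume Q: "r \<in> Q" "crossing_closed (K \<union> R) Q"
      then have QR: "crossing_closed R Q" "crossing_closed K Q"
        unfolding crossing_closed_def by blast+
      \<comment> \<open>The crossing with the root carries Q from R over to K.\<close>
      have "{s, t} \<in> Q"
        using Q cr r(1) st(1) unfolding crossing_closed_def by blast
      then show "K \<union> R \<subseteq> Q"
        using connected_diagramD[OF coR r(1) Q(1) QR(1)]
          connected_diagramD[OF coK st(1) _ QR(2)] by blast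
    qed
  qed
  then show "K \<union> R \<in> connected_diagrams_on S"
    using ch un by (simp add: connected_diagrams_on_def)
  have "root_decomposition (K \<union> R) K R m c"
  proof
    show "Min (\<Union>(K \<union> R - {{m, c}})) \<in> \<Union>K"
    proof -
      let ?X = "\<Union>(K \<union> R - {{m, c}})"
      have rK: "{m, c} \<notin> K" using r(1) rc \<open>K \<inter> R = {}\<close> by auto
      then have TX: "T \<subseteq> ?X" using KT by auto
      have finX: "finite ?X"
        using chords_finite_Union[OF ch] by (rule finite_subset[rotated]) auto
      have X: "Min ?X \<in> ?X" using finX TX pq(1) by (intro Min_in) auto
      have "Min ?X \<noteq> m"
      proof
        assume "Min ?X = m"
        then obtain y where "y \<in> K \<union> R" "y \<noteq> {m, c}" "m \<in> y" using X by auto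
        then show False using chords_unique[OF ch, of y r m] r rc by blast
      qed
      moreover have "Min ?X \<in> S" using X un by auto
      moreover have "Min ?X \<notin> I"
        using pq(1,3) TX finX by (meson Min_le leD subsetD)
      ultimately show ?thesis by (simp add: KT T_def)
    qed
    show "m < t" if "t \<in> \<Union>(K \<union> R)" "t \<noteq> m" for t
      using that m_less un by auto
    show "{m, c} \<in> R" using r rc by simp
    show "\<exists>p q. {p, q} \<in> K \<and> p < c \<and> c < q" using st by blast
  qed (use ch \<open>K \<inter> R = {}\<close> coK sep in auto)
  then show "\<exists>b. root_decomposition (K \<union> R) K R (Min S) b"
    unfolding m_def by blast
qed

text \<open>K is the component of the least endpoint \<open>s\<close> that remains without the root.
  The point to show is that every endpoint outside K, except m, lies in the gap of K containing
  b.\<close>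

lemma inner_interval_decompose:
  assumes D: "D \<in> connected_diagrams_on S" and "finite S" "2 < card S"
  obtains I K R where "inner_interval S I" "K \<in> connected_diagrams_on (S - {Min S} - I)"
    "R \<in> connected_diagrams_on (insert (Min S) I)" "D = K \<union> R"
proof -
  define m where "m = Min S"
  have ch: "chords D" and un: "\<Union>D = S" and co: "connected_diagram D"
    using D by (auto simp: connected_diagrams_on_def)
  have mS: "m \<in> S" using assms unfolding m_def by (intro Min_in) auto
  have m_less: "m < t" if "t \<in> S" "t \<noteq> m" for t
    using that assms(2) unfolding m_def by (metis Min_le le_neq_trans)
  obtain r where r: "r \<in> D" "m \<in> r" using un mS by auto
  obtain a b where ab: "r = {a, b}" "a < b" using chords_obtain[OF ch r(1)] .
  have "a \<in> S" using ab r un by auto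
  then have am: "a = m" using m_less[of a] ab r(2) by auto
  have rb: "r = {m, b}" "m < b" using ab am by auto
  define E where "E = D - {r}"
  have chE: "chords E" using ch unfolding E_def by (rule chords_subset) auto
  have finE: "finite (\<Union>E)" using chE by (rule chords_finite_Union)
  have "E \<noteq> {}"
  proof
    assume "E = {}"
    then have "D = {r}" using r(1) by (auto simp: E_def)
    then show False using chords_card_Union[OF ch] un assms(3) by simp
  qed
  then have "\<Union>E \<noteq> {}" using chE by (fastforce simp: chords_def)
  define s where "s = Min (\<Union>E)"
  have sE: "s \<in> \<Union>E" unfolding s_def using finE \<open>\<Union>E \<noteq> {}\<close> by (rule Min_in)
  then obtain z where z: "z \<in> E" "s \<in> z" by auto
  define K where "K = linked E `` {z}"
  have KC: "K \<in> diagram_components E"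
    using z(1) by (auto simp: K_def diagram_components_def intro: quotientI)
  have KE: "K \<subseteq> E" and coK: "connected_diagram K" and clK: "crossing_closed E K"
    using KC by (auto simp: diagram_components_iff)
  have zK: "z \<in> K" using z(1) by (auto simp: K_def linked_def)
  have chK: "chords K" using chE KE by (rule chords_subset)
  define R where "R = D - K"
  define T where "T = \<Union>K"
  define I where "I = S - {m} - T"
  have rK: "r \<notin> K" using KE by (auto simp: E_def)
  have rR: "r \<in> R" using r rK by (auto simp: R_def)
  have chR: "chords R" using ch unfolding R_def by (rule chords_subset) auto
  have KR: "D = K \<union> R" using KE by (auto simp: R_def E_def)
  have sep: "\<not> crossing u v" if "u \<in> K" "v \<in> R" "v \<noteq> r" for u v
    using clK that KE unfolding crossing_closed_def R_def E_def by blast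
  have disj: "t \<notin> v" if "t \<in> T" "v \<in> R" for t v
    using that chords_unique[OF ch] KE unfolding T_def R_def E_def by blast
  have TS: "T \<subseteq> S" using un KR by (auto simp: T_def)
  have mT: "m \<notin> T" using disj rR r(2) by blast
  have bT: "b \<notin> T" using disj rR rb by blast
  have bS: "b \<in> S" using r(1) rb un by auto
  have RI: "\<Union>R = insert m I"
  proof
    show "\<Union>R \<subseteq> insert m I" using disj un KR by (fastforce simp: I_def)
    show "insert m I \<subseteq> \<Union>R" using rR r(2) un KR by (auto simp: I_def T_def)
  qed
  \<comment> \<open>Otherwise K would be closed under crossing in D, and connectedness would force
    the root into K.\<close>
  obtain w where w: "w \<in> K" "crossing r w"
  proof (rule ccontr)
    assume no: "\<not> thesis"
    have "crossing_closed D K"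
      unfolding crossing_closed_def
    proof (intro ballI impI)
      fix u v assume "u \<in> D \<inter> K" "v \<in> D" "crossing u v"
      then show "v \<in> K" using sep[of u v] no that crossing_commute KR by blast
    qed
    then have "D \<subseteq> K" using connected_diagramD[OF co _ zK] zK KR by auto
    then show False using r(1) rK by auto
  qed
  obtain p q where pq: "w = {p, q}" "p < q" using chords_obtain[OF chK w(1)] .
  have pqT: "p \<in> T" "q \<in> T" using pq w(1) by (auto simp: T_def)
  have "m < p" using pqT(1) TS mT m_less by blast
  then have pbq: "p < b" "b < q"
    using w(2) crossing_doubletons[OF rb(2) pq(2)] rb pq by auto
  have sp: "s \<le> p" using pqT(1) KE finE unfolding s_def T_def by (intro Min_le) auto
  have sT: "s \<in> T" using zK z(2) by (auto simp: T_def)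
  \<comment> \<open>The chord starts no earlier than \<open>s\<close>, so \<open>s\<close> is not
    under it, and the rest of K follows \<open>s\<close>.\<close>
  have gap: "\<not> (c < t \<and> t < d)" if v: "{c, d} \<in> R" "{c, d} \<noteq> r" "c < d" and t: "t \<in> T" for c d t
  proof (rule noncrossing_connected_outside[OF chK coK v(3), of s])
    have "{c, d} \<in> E" using v KR by (auto simp: E_def)
    then have "c \<in> \<Union>E" by blast
    then have "s \<le> c" using finE unfolding s_def by (intro Min_le)
    then show "\<not> (c < s \<and> s < d)" by simp
    show "\<not> crossing x {c, d} \<and> c \<notin> x \<and> d \<notin> x" if "x \<in> K" for x
      using sep[OF that v(1,2)] disj[OF _ v(1)] that unfolding T_def by blast
  qed (use sT t in \<open>auto simp: T_def\<close>)
  \<comment> \<open>For x outside T this means that x and b lie in the same gap of T.\<close>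
  define same where "same x \<longleftrightarrow> (\<forall>t\<in>T. t < x \<longleftrightarrow> t < b)" for x
  have same: "same x" if "x \<in> I" for x
  proof -
    \<comment> \<open>K is added to make the set closed; the root is exempt because its end m lies
      to the left of T.\<close>
    let ?Q = "K \<union> {r} \<union> {v. \<forall>x\<in>v. same x}"
    have "D \<subseteq> ?Q"
    proof (rule connected_diagramD[OF co r(1)])
      show "crossing_closed D ?Q"
        unfolding crossing_closed_def
      proof (intro ballI impI)
        fix u v assume u: "u \<in> D \<inter> ?Q" and v: "v \<in> D" and uv: "crossing u v"
        show "v \<in> ?Q"
        proof (cases "v \<in> K \<or> v = r \<or> u \<in> K")
          case True
          then show ?thesis using sep[of u v] v uv KR by auto
        next
          case False
          then have vR: "v \<in> R" "v \<noteq> r" using v KR by auto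
          obtain c d where cd: "v = {c, d}" "c < d" using chords_obtain[OF chR vR(1)] .
          have ncd: "\<not> (c < t \<and> t < d)" "t \<noteq> c" "t \<noteq> d" if "t \<in> T" for t
            using gap[of c d t] vR cd that disj[OF that vR(1)] by auto
          have uD: "u \<in> D" using u by simp
          obtain e f where ef: "u = {e, f}" "e < f" using chords_obtain[OF ch uD] .
          have cr: "e < c \<and> c < f \<and> f < d \<or> c < e \<and> e < d \<and> d < f"
            using uv crossing_doubletons[OF ef(2) cd(2)] ef cd by simp
          \<comment> \<open>An endpoint of \<open>u\<close> between c and d: b if \<open>u\<close>
            is the root, otherwise the end that the crossing puts there. As {c, d} passes over no
            point of T, both its ends share the gap of \<open>y\<close>.\<close>
          obtain y where y: "same y" "c < y" "y < d"
          proof (cases "u = r")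
            case True
            then have "e = m" "f = b" using ef rb by (auto simp: doubleton_eq_iff)
            moreover have "c \<in> S" using v cd(1) un by auto
            then have "m \<le> c"
              using m_less[of c] by (cases "c = m") auto
            ultimately show ?thesis using that[of b] cr by (auto simp: same_def)
          next
            case F: False
            then have "same e" "same f" using u False ef by auto
            then show ?thesis using that[of e] that[of f] cr by auto
          qed
          have "same c" "same d"
            using y ncd unfolding same_def by (meson less_trans not_less_iff_gr_or_eq)+
          then show ?thesis using cd by auto
        qed
      qed
    qed auto
    moreover obtain v where v: "v \<in> R" "x \<in> v" using \<open>x \<in> I\<close> RI by blast
    ultimately have "v = r \<or> same x"
      using disj KR that rK unfolding R_def by auto
    moreover have "x \<noteq> m" using that by (auto simp: I_def)
    ultimately show ?thesis using v rb by (auto simp: same_def)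
  qed
  have bI: "b \<in> I" using bS bT rb by (auto simp: I_def)
  have T_eq: "S - {m} - I = T" using TS mT by (auto simp: I_def)
  have int: "inner_interval S I"
    unfolding inner_interval_def m_def[symmetric] T_eq
  proof (intro conjI)
    show "I \<noteq> {}" using bI by auto
    show "I \<subseteq> S - {m}" by (auto simp: I_def)
    have "p < x \<and> x < q" if "x \<in> I" for x
    proof -
      have "x \<noteq> q" using that pqT by (auto simp: I_def)
      then show ?thesis using same[OF that] pqT pbq unfolding same_def by (meson less_asym linorder_neqE_nat)
    qed
    then show "\<exists>p\<in>T. \<exists>q\<in>T. \<forall>x\<in>I. p < x \<and> x < q"
      using pqT by blast
    show "\<forall>t\<in>T. \<forall>x\<in>I. \<forall>y\<in>I. t < x \<longrightarrow> t < y"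
      using same by (simp add: same_def)
  qed
  have "connected_diagram R"
  proof (subst connected_diagram_iff[OF rR], intro allI impI)
    fix Q assume Q: "r \<in> Q" "crossing_closed R Q"
    \<comment> \<open>Any crossing between K and R involves the root, which Q already
      contains.\<close>
    have "crossing_closed D (Q \<union> K)"
      unfolding crossing_closed_def
    proof (intro ballI impI)
      fix u v assume "u \<in> D \<inter> (Q \<union> K)" "v \<in> D" "crossing u v"
      then show "v \<in> Q \<union> K"
        using sep[of u v] Q KR unfolding crossing_closed_def by blast
    qed
    then have "D \<subseteq> Q \<union> K" using connected_diagramD[OF co r(1)] Q(1) by blast
    then show "R \<subseteq> Q" by (auto simp: R_def)
  qed
  then have "R \<in> connected_diagrams_on (insert (Min S) I)"
    using chR RI by (simp add: connected_diagrams_on_def m_def)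
  moreover have "K \<in> connected_diagrams_on (S - {Min S} - I)"
    using chK coK T_eq by (simp add: connected_diagrams_on_def T_def m_def)
  ultimately show ?thesis using that int KR by blast
qed

section \<open>Counting recursions\<close>

lemma singleton_diagram:
  assumes "card S = 2"
  shows "connected_diagrams_on S = {{S}}" "has_terminal_chord {S}" "first_terminal_index {S} = 1"
proof -
  obtain a b where ab: "S = {a, b}" "a < b" using card_2_less_obtain[OF assms] .
  have ch: "chords {S}" using assms by (simp add: chords_def)
  show "connected_diagrams_on S = {{S}}"
  proof
    show "{{S}} \<subseteq> connected_diagrams_on S"
      using ch by (auto simp: connected_diagrams_on_def connected_diagram_def linked_def)
    show "connected_diagrams_on S \<subseteq> {{S}}"
    proof
      fix D assume "D \<in> connected_diagrams_on S"
      then have D: "chords D" "\<Union>D = S" by (auto simp: connected_diagrams_on_def)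
      then have "card D = 1" using chords_card_Union[of D] assms by simp
      then obtain x where "D = {x}" by (rule card_1_singletonE)
      then show "D \<in> {{S}}" using D by simp
    qed
  qed
  have "root_chord {S} = S"
    by (rule root_chord_eq[OF ch]) (use ab in auto)
  then have io: "intersection_order {S} = [S]"
    by (subst intersection_order.simps) (simp add: ordered_components_def diagram_components_def)
  have t: "terminal {S} S"
    using ab by (auto simp: terminal_def intersection_graph_def doubleton_eq_iff)
  show h: "has_terminal_chord {S}"
    using t by (simp add: has_terminal_chord_def io)
  have "(LEAST i. i < length (intersection_order {S}) \<and> terminal {S} (intersection_order {S} ! i)) = 0"
    using t by (intro Least_eq_0) (simp add: io)
  then show "first_terminal_index {S} = 1"
    using first_terminal_index_eq_Least[OF h] by simp
qed

text \<open>The triple is read off from D: K is its first component, R is what remains, and I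
  consists of the endpoints of R other than the minimum. The size of I is odd because R pairs up the
  points of I and the minimum.\<close>

lemma connected_diagrams_on_decomposition:
  assumes "finite S" "2 < card S"
  shows "bij_betw (\<lambda>(I, K, R). K \<union> R)
    (SIGMA I:{I. inner_interval S I \<and> odd (card I)}.
       connected_diagrams_on (S - {Min S} - I) \<times> connected_diagrams_on (insert (Min S) I))
    (connected_diagrams_on S)"
    (is "bij_betw ?f ?A ?B")
  unfolding bij_betw_def
proof (intro conjI equalityI)
  show "inj_on ?f ?A"
  proof (rule inj_on_inverseI)
    fix x assume x: "x \<in> ?A"
    obtain I K R where xe: "x = (I, K, R)" by (cases x)
    have I: "inner_interval S I" and K: "K \<in> connected_diagrams_on (S - {Min S} - I)"
      and R: "R \<in> connected_diagrams_on (insert (Min S) I)"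
      using x xe by auto
    obtain b where "root_decomposition (K \<union> R) K R (Min S) b"
      using inner_interval_compose(2)[OF assms(1) I K R] by blast
    then interpret root_decomposition "K \<union> R" K R "Min S" b .
    have "\<Union>R - {Min S} = I"
      using I R by (auto simp: inner_interval_def connected_diagrams_on_def)
    moreover have "K \<union> R - K = R" using disjnt by auto
    ultimately show "(\<lambda>D. let L = hd (ordered_components (D - {root_chord D})) in
        (\<Union>(D - L) - {Min S}, L, D - L)) (?f x) = x"
      using component_eq by (simp add: xe Let_def)
  qed
  show "?f ` ?A \<subseteq> ?B"
    using inner_interval_compose(1)[OF assms(1)] by auto
  show "?B \<subseteq> ?f ` ?A"
  proof
    fix D assume "D \<in> ?B"
    then obtain I K R where *: "inner_interval S I" "K \<in> connected_diagrams_on (S - {Min S} - I)"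
      "R \<in> connected_diagrams_on (insert (Min S) I)" "D = K \<union> R"
      using inner_interval_decompose assms by metis
    have "card (insert (Min S) I) = 2 * card R"
      using *(3) chords_card_Union[of R] by (auto simp: connected_diagrams_on_def)
    moreover have I: "I \<subseteq> S - {Min S}" using *(1) by (simp add: inner_interval_def)
    moreover have "finite I" using I assms(1) by (meson finite_Diff finite_subset)
    moreover have "Min S \<notin> I" using I by blast
    ultimately have "Suc (card I) = 2 * card R" by simp
    then have "odd (card I)" by presburger
    then have "(I, K, R) \<in> ?A" using * by auto
    then show "D \<in> ?f ` ?A" using *(4) by (intro image_eqI[of _ _ "(I, K, R)"]) auto
  qed
qed

text \<open>Position 0 is the minimum and a point of K has to precede I, whence 2 <= i; another has
  to follow I, whence j < N.\<close>

lemma inner_interval_enumerate: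
  assumes S: "finite S" "card S = N" and h: "bij_betw h {..<N} S" "strict_mono_on {..<N} h"
  shows "inner_interval S I \<longleftrightarrow> (\<exists>i j. 2 \<le> i \<and> i < j \<and> j < N \<and> I = h ` {i..<j})"
proof (cases "N = 0")
  case True
  then have "S = {}" using S by simp
  then show ?thesis using True by (auto simp: inner_interval_def)
next
  case False
  have less: "h a < h c \<longleftrightarrow> a < c" if "a < N" "c < N" for a c
    using strict_mono_on_less[OF h(2)] that by simp
  have S_eq: "S = h ` {..<N}" using h(1) by (simp add: bij_betw_def)
  have inj: "a = c" if "h a = h c" "a < N" "c < N" for a c
    using h(1) that by (auto simp: bij_betw_def inj_on_def)
  have Min: "Min S = h 0"
    unfolding S_eq using False less
    by (intro Min_eqI) (auto simp: order.order_iff_strict dest: less)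
  show ?thesis
  proof
    assume "\<exists>i j. 2 \<le> i \<and> i < j \<and> j < N \<and> I = h ` {i..<j}"
    then obtain i j where ij: "2 \<le> i" "i < j" "j < N" "I = h ` {i..<j}" by blast
    have notin: "h l \<in> I \<longleftrightarrow> i \<le> l \<and> l < j" if "l < N" for l
      using inj[of l] that ij by force
    show "inner_interval S I"
      unfolding inner_interval_def Min
    proof (intro conjI)
      show "I \<noteq> {}" using ij by auto
      show "I \<subseteq> S - {h 0}"
        using ij inj[of _ 0] by (fastforce simp: S_eq)
      show "\<exists>p\<in>S - {h 0} - I. \<exists>q\<in>S - {h 0} - I. \<forall>x\<in>I. p < x \<and> x < q"
      proof -
        have "h 1 \<in> S - {h 0} - I"
          using ij notin[of 1] inj[of 1 0] by (auto simp: S_eq)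
        moreover have "h j \<in> S - {h 0} - I"
          using ij notin[of j] inj[of j 0] by (auto simp: S_eq)
        moreover have "\<forall>x\<in>I. h 1 < x \<and> x < h j"
          using ij by (auto simp: less)
        ultimately show ?thesis by blast
      qed
      show "\<forall>t\<in>S - {h 0} - I. \<forall>x\<in>I. \<forall>y\<in>I. t < x \<longrightarrow> t < y"
      proof (intro ballI impI)
        fix t x y assume "t \<in> S - {h 0} - I" "x \<in> I" "y \<in> I" "t < x"
        moreover from this obtain l where "t = h l" "l < N" by (auto simp: S_eq)
        moreover from calculation have "\<not> (i \<le> l \<and> l < j)" using notin[of l] by auto
        moreover obtain x' y' where "x = h x'" "i \<le> x'" "x' < j" "y = h y'" "i \<le> y'" "y' < j"
          using \<open>x \<in> I\<close> \<open>y \<in> I\<close> ij(4) by auto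
        ultimately show "t < y" using less[of l x'] less[of l y'] ij(3) by auto
      qed
    qed
  next
    assume I: "inner_interval S I"
    define J where "J = {l. l < N \<and> h l \<in> I}"
    have "I \<subseteq> h ` {..<N}" "I \<noteq> {}" using I by (auto simp: inner_interval_def S_eq[symmetric])
    then have IJ: "I = h ` J" by (auto simp: J_def)
    have J: "finite J" by (simp add: J_def)
    have J': "J \<noteq> {}" using \<open>I \<noteq> {}\<close> IJ by blast
    obtain p q where pq: "p \<in> S - {h 0} - I" "q \<in> S - {h 0} - I" "\<And>x. x \<in> I \<Longrightarrow> p < x \<and> x < q"
      using I unfolding inner_interval_def Min by blast
    obtain p' q' where p': "p = h p'" "p' < N" and q': "q = h q'" "q' < N"
      using pq(1,2) by (auto simp: S_eq)
    have "p' \<noteq> 0" using p' pq(1) by (cases p') auto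
    have between: "p' < l \<and> l < q'" if "l \<in> J" for l
      using pq(3)[of "h l"] that p' q' less by (auto simp: J_def)
    have MJ: "Min J \<in> J" "Max J \<in> J" using J J' by auto
    have "2 \<le> Min J" using between[OF MJ(1)] \<open>p' \<noteq> 0\<close> by simp
    moreover have "Suc (Max J) < N" using between[OF MJ(2)] q' by simp
    moreover have "Min J < Suc (Max J)" using J MJ by (simp add: less_Suc_eq_le)
    moreover have "J = {Min J..<Suc (Max J)}"
    proof
      show "J \<subseteq> {Min J..<Suc (Max J)}" using J by (auto simp: less_Suc_eq_le)
      show "{Min J..<Suc (Max J)} \<subseteq> J"
      proof
        fix l assume l: "l \<in> {Min J..<Suc (Max J)}"
        have N: "l < N" "Min J < N" "Max J < N" using l MJ by (auto simp: J_def)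
        show "l \<in> J"
        proof (rule ccontr)
          \<comment> \<open>A missing position between the extremes would be a point outside I that
            separates two points of I.\<close>
          assume nl: "l \<notin> J"
          have "l \<noteq> 0" using l \<open>2 \<le> Min J\<close> by auto
          then have "h l \<noteq> h 0" using inj[of l 0] N by auto
          moreover have "h l \<notin> I" using nl N by (simp add: J_def)
          moreover have "h l \<in> S" using N by (simp add: S_eq)
          ultimately have "h l \<in> S - {Min S} - I" by (simp add: Min)
          moreover have "h (Min J) \<in> I" "h (Max J) \<in> I" using MJ by (auto simp: J_def)
          ultimately have "h l < h (Max J) \<longrightarrow> h l < h (Min J)"
            using I unfolding inner_interval_def by blast
          moreover have "l \<noteq> Max J" using nl MJ by auto
          ultimately show False using l N less by auto
        qed
      qed
    qed
    ultimately show "\<exists>i j. 2 \<le> i \<and> i < j \<and> j < N \<and> I = h ` {i..<j}"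
      using IJ by metis
  qed
qed

text \<open>If K takes 2k points, I has 2(n - k) - 1 points and leaves the last position free, so
  its start runs over 2..2k: one choice for each of the 2k - 1 gaps between consecutive points of
  K.\<close>

lemma bij_betw_inner_intervals:
  assumes S: "finite S" "card S = 2 * n" and h: "bij_betw h {..<2 * n} S" "strict_mono_on {..<2 * n} h"
  shows "bij_betw (\<lambda>(k, i). h ` {i..<i + (2 * (n - k) - 1)}) (SIGMA k:{1..<n}. {2..2 * k})
    {I. inner_interval S I \<and> odd (card I)}"
    (is "bij_betw ?f ?P ?Q")
proof -
  have inj: "inj_on h {..<2 * n}" using h(1) by (simp add: bij_betw_def)
  have card: "card (h ` {i..<j}) = j - i" if "j \<le> 2 * n" for i j
    using inj that by (subst card_image) (auto intro: inj_on_subset)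
  show ?thesis
    unfolding bij_betw_def
  proof (intro conjI equalityI)
    show "inj_on ?f ?P"
    proof (rule inj_onI)
      fix x y assume x: "x \<in> ?P" and y: "y \<in> ?P" and eq: "?f x = ?f y"
      obtain k i l j where xy: "x = (k, i)" "y = (l, j)" by (cases x, cases y)
      have ki: "1 \<le> k" "k < n" "2 \<le> i" "i \<le> 2 * k" "1 \<le> l" "l < n" "2 \<le> j" "j \<le> 2 * l"
        using x y xy by auto
      have "h ` {i..<i + (2 * (n - k) - 1)} = h ` {j..<j + (2 * (n - l) - 1)}"
        using eq xy by simp
      then have "{i..<i + (2 * (n - k) - 1)} = {j..<j + (2 * (n - l) - 1)}"
        using ki by (subst (asm) inj_on_image_eq_iff[OF inj]) auto
      then have "i = j \<and> i + (2 * (n - k) - 1) = j + (2 * (n - l) - 1)"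
        using ki by (subst (asm) atLeastLessThan_eq_iff) auto
      then show "x = y" using ki xy by auto
    qed
    show "?f ` ?P \<subseteq> ?Q"
    proof
      fix I assume "I \<in> ?f ` ?P"
      then obtain k i where ki: "1 \<le> k" "k < n" "2 \<le> i" "i \<le> 2 * k"
        and I: "I = h ` {i..<i + (2 * (n - k) - 1)}"
        by auto
      have "inner_interval S I"
        unfolding inner_interval_enumerate[OF S h]
        using ki I by (intro exI[of _ i] exI[of _ "i + (2 * (n - k) - 1)"]) auto
      moreover have "odd (card I)"
        using ki by (simp add: I card)
      ultimately show "I \<in> ?Q" by simp
    qed
    show "?Q \<subseteq> ?f ` ?P"
    proof
      fix I assume "I \<in> ?Q"
      then obtain i j where ij: "2 \<le> i" "i < j" "j < 2 * n" "I = h ` {i..<j}" and "odd (card I)"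
        using inner_interval_enumerate[OF S h] by auto
      then have "odd (j - i)" using card by simp
      then obtain d where d: "j - i = 2 * d + 1" by (elim oddE)
      define k where "k = n - Suc d"
      have "1 \<le> k" "k < n" "i \<le> 2 * k" "j = i + (2 * (n - k) - 1)"
        using ij d by (auto simp: k_def)
      then show "I \<in> ?f ` ?P"
        using ij by (intro image_eqI[of _ _ "(k, i)"]) auto
    qed
  qed
qed

text \<open>The number of connected diagrams with n chords, from n = 1 on: 1, 1, 4, 27, 248, ... The
  value 0 at n = 0 agrees with the convention that the empty diagram is not connected.\<close>

fun diagram_count :: "nat \<Rightarrow> nat" where
  "diagram_count n =
     (if n \<le> 1 then n else \<Sum>k\<in>{1..<n}. (2 * k - 1) * (diagram_count k * diagram_count (n - k)))"

declare diagram_count.simps [simp del]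

text \<open>The sum of \<open>first_terminal_index\<close> over the connected diagrams with n
  chords. The summand \<open>diagram_count n\<close> collects the 1 that the root adds to each
  index.\<close>

fun index_total :: "nat \<Rightarrow> nat" where
  "index_total n =
     (if n \<le> 1 then n else diagram_count n +
        (\<Sum>k\<in>{1..<n}. (2 * k - 1) * (index_total k * diagram_count (n - k))))"

declare index_total.simps [simp del]

text \<open>S is arbitrary because K and R do not live on initial segments. The claims are proved
  jointly: the index shift requires a terminal chord in K.\<close>

lemma connected_diagrams_on_statistics:
  assumes "finite S" "card S = 2 * n" "1 \<le> n"
  shows "card (connected_diagrams_on S) = diagram_count n \<and>
    (\<forall>D\<in>connected_diagrams_on S. has_terminal_chord D) \<and>
    (\<Sum>D\<in>connected_diagrams_on S. first_terminal_index D) = index_total n"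
  using assms
proof (induction n arbitrary: S rule: less_induct)
  case (less n)
  show ?case
  proof (cases "n = 1")
    case True
    then show ?thesis
      using less.prems singleton_diagram[of S]
      by (simp add: diagram_count.simps index_total.simps)
  next
    case False
    with less.prems have n: "2 \<le> n" and card2: "2 < card S" by auto
    obtain h where h: "bij_betw h {..<2 * n} S" "strict_mono_on {..<2 * n} h"
      using ex_bij_betw_strict_mono_card[OF less.prems(1)] less.prems(2) by metis
    define iv where "iv k i = h ` {i..<i + (2 * (n - k) - 1)}" for k i
    define outer where "outer I = connected_diagrams_on (S - {Min S} - I)" for I
    define inner where "inner I = connected_diagrams_on (insert (Min S) I)" for I
    define Is where "Is = {I. inner_interval S I \<and> odd (card I)}"
    note bij = connected_diagrams_on_decomposition[OF less.prems(1) card2,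
        folded outer_def inner_def Is_def]
    note bij2 = bij_betw_inner_intervals[OF less.prems(1,2) h, folded iv_def Is_def]
    have fin: "finite (outer I)" "finite (inner I)" if "I \<in> Is" for I
      using that less.prems(1) unfolding outer_def inner_def Is_def inner_interval_def
      by (auto intro!: finite_connected_diagrams_on intro: finite_subset)
    have "Is \<subseteq> Pow S" by (auto simp: Is_def inner_interval_def)
    then have finIs: "finite Is" using less.prems(1) by (meson finite_Pow_iff finite_subset)
    have cards: "card (S - {Min S} - iv k i) = 2 * k" "card (insert (Min S) (iv k i)) = 2 * (n - k)"
        "finite (insert (Min S) (iv k i))"
      if "k \<in> {1..<n}" "i \<in> {2..2 * k}" for k i
    proof -
      have "(\<lambda>(k, i). iv k i) (k, i) \<in> Is"
        using bij2 that by (intro bij_betw_apply[OF bij2]) auto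
      then have I: "iv k i \<subseteq> S - {Min S}" by (simp add: Is_def inner_interval_def)
      have "{i..<i + (2 * (n - k) - 1)} \<subseteq> {..<2 * n}" using that by auto
      then have "inj_on h {i..<i + (2 * (n - k) - 1)}"
        using h(1) inj_on_subset unfolding bij_betw_def by blast
      then have c: "card (iv k i) = 2 * (n - k) - 1"
        unfolding iv_def by (subst card_image) auto
      have "S \<noteq> {}" using card2 by auto
      then have m: "Min S \<in> S" using less.prems(1) by simp
      have f: "finite (iv k i)" unfolding iv_def by simp
      then show "finite (insert (Min S) (iv k i))" by simp
      show "card (insert (Min S) (iv k i)) = 2 * (n - k)"
        using I f c that by (subst card_insert_disjoint) auto
      show "card (S - {Min S} - iv k i) = 2 * k"
        using I f c m less.prems that by (subst card_Diff_subset) auto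
    qed
    have IHo: "card (outer (iv k i)) = diagram_count k"
        "\<forall>D\<in>outer (iv k i). has_terminal_chord D"
        "(\<Sum>D\<in>outer (iv k i). first_terminal_index D) = index_total k"
      and IHi: "card (inner (iv k i)) = diagram_count (n - k)"
      if "k \<in> {1..<n}" "i \<in> {2..2 * k}" for k i
      using less.IH[of k "S - {Min S} - iv k i"] less.IH[of "n - k" "insert (Min S) (iv k i)"]
        cards[OF that] that less.prems(1)
      by (auto simp: outer_def inner_def)
    \<comment> \<open>Both bijections in one formula for any statistic; it serves for the constant 1
      and for the index.\<close>
    have sum_decomp: "(\<Sum>D\<in>connected_diagrams_on S. \<phi> D) =
        (\<Sum>k\<in>{1..<n}. \<Sum>i\<in>{2..2 * k}. \<Sum>K\<in>outer (iv k i). \<Sum>R\<in>inner (iv k i). \<phi> (K \<union> R))"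
      for \<phi> :: "chord set \<Rightarrow> nat"
    proof -
      have "(\<Sum>D\<in>connected_diagrams_on S. \<phi> D) =
          (\<Sum>(I, K, R)\<in>(SIGMA I:Is. outer I \<times> inner I). \<phi> (K \<union> R))"
        by (subst sum.reindex_bij_betw[OF bij, symmetric]) (simp add: case_prod_unfold)
      also have "\<dots> = (\<Sum>I\<in>Is. \<Sum>(K, R)\<in>outer I \<times> inner I. \<phi> (K \<union> R))"
        using finIs fin by (subst sum.Sigma) (auto simp: case_prod_unfold)
      also have "\<dots> = (\<Sum>I\<in>Is. \<Sum>K\<in>outer I. \<Sum>R\<in>inner I. \<phi> (K \<union> R))"
        by (simp add: sum.cartesian_product)
      also have "\<dots> = (\<Sum>(k, i)\<in>(SIGMA k:{1..<n}. {2..2 * k}).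
          \<Sum>K\<in>outer (iv k i). \<Sum>R\<in>inner (iv k i). \<phi> (K \<union> R))"
        by (subst sum.reindex_bij_betw[OF bij2, symmetric]) (simp add: case_prod_unfold)
      finally show ?thesis by (simp add: sum.Sigma)
    qed
    have step: "has_terminal_chord (K \<union> R)"
        "first_terminal_index (K \<union> R) = Suc (first_terminal_index K)"
      if ki: "k \<in> {1..<n}" "i \<in> {2..2 * k}" and KR: "K \<in> outer (iv k i)" "R \<in> inner (iv k i)"
      for k i K R
    proof -
      have "(\<lambda>(k, i). iv k i) (k, i) \<in> Is"
        using ki by (intro bij_betw_apply[OF bij2]) auto
      then have "inner_interval S (iv k i)" by (simp add: Is_def)
      then obtain b where "root_decomposition (K \<union> R) K R (Min S) b"
        using inner_interval_compose(2)[OF less.prems(1)] KR unfolding outer_def inner_def by blast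
      then interpret root_decomposition "K \<union> R" K R "Min S" b .
      have "has_terminal_chord K" using IHo(2)[OF ki] KR(1) by blast
      then show "has_terminal_chord (K \<union> R)"
          "first_terminal_index (K \<union> R) = Suc (first_terminal_index K)"
        by (fact first_terminal_index_Suc)+
    qed
    have "card (connected_diagrams_on S) = (\<Sum>D\<in>connected_diagrams_on S. 1)" by simp
    also have "\<dots> = (\<Sum>k\<in>{1..<n}. \<Sum>i\<in>{2..2 * k}. diagram_count k * diagram_count (n - k))"
      unfolding sum_decomp using IHo(1) IHi by (intro sum.cong) auto
    also have "\<dots> = diagram_count n"
      using n by (subst diagram_count.simps) simp
    finally have count: "card (connected_diagrams_on S) = diagram_count n" .
    have terminal: "has_terminal_chord D" if D: "D \<in> connected_diagrams_on S" for D
    proof -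
      obtain I K R where "I \<in> Is" and KR: "K \<in> outer I" "R \<in> inner I" "D = K \<union> R"
        using D unfolding bij_betw_imp_surj_on[OF bij, symmetric] by auto
      moreover from this obtain k i where "k \<in> {1..<n}" "i \<in> {2..2 * k}" "I = iv k i"
        unfolding bij_betw_imp_surj_on[OF bij2, symmetric] by auto
      ultimately show ?thesis using step(1) by blast
    qed
    have "(\<Sum>D\<in>connected_diagrams_on S. first_terminal_index D) =
        (\<Sum>k\<in>{1..<n}. \<Sum>i\<in>{2..2 * k}. \<Sum>K\<in>outer (iv k i). \<Sum>R\<in>inner (iv k i).
          Suc (first_terminal_index K))"
      unfolding sum_decomp using step(2) by (intro sum.cong refl) auto
    also have "\<dots> = (\<Sum>k\<in>{1..<n}. \<Sum>i\<in>{2..2 * k}.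
        (diagram_count k + index_total k) * diagram_count (n - k))"
    proof (intro sum.cong refl)
      fix k i assume ki: "k \<in> {1..<n}" "i \<in> {2..2 * k}"
      have "(\<Sum>K\<in>outer (iv k i). Suc (first_terminal_index K)) = diagram_count k + index_total k"
        using IHo[OF ki] by (simp add: sum_Suc)
      moreover have "(\<Sum>K\<in>outer (iv k i). \<Sum>R\<in>inner (iv k i). Suc (first_terminal_index K)) =
          (\<Sum>K\<in>outer (iv k i). Suc (first_terminal_index K) * card (inner (iv k i)))"
        by (simp add: mult.commute)
      ultimately show "(\<Sum>K\<in>outer (iv k i). \<Sum>R\<in>inner (iv k i). Suc (first_terminal_index K)) =
          (diagram_count k + index_total k) * diagram_count (n - k)"
        using IHi[OF ki] by (simp only: sum_distrib_right[symmetric])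
    qed
    also have "\<dots> = index_total n"
      using n by (subst index_total.simps, subst diagram_count.simps[of n])
        (simp add: sum.distrib[symmetric] algebra_simps)
    finally show ?thesis using count terminal by blast
  qed
qed

section \<open>Asymptotics\<close>

text \<open>n / \<mu> nearly solves the recursion: the difference \<open>u\<close> satisfies it with
  a source \<delta> tending to 0 in place of 1. The average runs over k <= n - 1, so a bound
  \<epsilon> n + M gains \<epsilon> at each step, which absorbs \<delta>. Thus \<open>u\<close> is
  o(n).\<close>

lemma linear_recursion_limit:
  fixes F :: "nat \<Rightarrow> real" and p :: "nat \<Rightarrow> nat \<Rightarrow> real"
  assumes p: "\<And>n k. 0 \<le> p n k" "\<And>n. 2 \<le> n \<Longrightarrow> (\<Sum>k\<in>{1..<n}. p n k) = 1"
    and F: "\<And>n. 2 \<le> n \<Longrightarrow> F n = 1 + (\<Sum>k\<in>{1..<n}. p n k * F k)"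
    and \<mu>: "(\<lambda>n. \<Sum>k\<in>{1..<n}. p n k * (real n - real k)) \<longlonglongrightarrow> \<mu>" "0 < \<mu>"
  shows "(\<lambda>n. F n / real n) \<longlonglongrightarrow> 1 / \<mu>"
proof -
  define u where "u n = F n - real n / \<mu>" for n
  define \<delta> where "\<delta> n = 1 - (\<Sum>k\<in>{1..<n}. p n k * (real n - real k)) / \<mu>" for n
  have "\<delta> \<longlonglongrightarrow> 1 - \<mu> / \<mu>"
    unfolding \<delta>_def using \<mu> by (intro tendsto_intros) auto
  then have \<delta>: "\<delta> \<longlonglongrightarrow> 0" using \<mu>(2) by simp
  have u: "u n = (\<Sum>k\<in>{1..<n}. p n k * u k) + \<delta> n" if n: "2 \<le> n" for n
  proof -
    have "(\<Sum>k\<in>{1..<n}. p n k * (real n - real k)) =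
        real n * (\<Sum>k\<in>{1..<n}. p n k) - (\<Sum>k\<in>{1..<n}. p n k * real k)"
      by (simp add: sum_distrib_left sum_subtractf[symmetric] algebra_simps)
    moreover have "(\<Sum>k\<in>{1..<n}. p n k * u k) =
        (\<Sum>k\<in>{1..<n}. p n k * F k) - (\<Sum>k\<in>{1..<n}. p n k * real k) / \<mu>"
      by (simp add: u_def sum_divide_distrib sum_subtractf[symmetric] algebra_simps)
    ultimately show ?thesis
      using F[OF n] p(2)[OF n] \<mu>(2) by (simp add: u_def \<delta>_def field_simps)
  qed
  have bound: "\<exists>M. \<forall>n\<ge>1. \<bar>u n\<bar> \<le> \<epsilon> * real n + M" if \<epsilon>: "0 < \<epsilon>" for \<epsilon>
  proof -
    from \<delta> \<epsilon> obtain N where N: "\<And>n. N \<le> n \<Longrightarrow> \<bar>\<delta> n\<bar> < \<epsilon>"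
      by (auto simp: LIMSEQ_iff)
    \<comment> \<open>M covers the initial range, where \<delta> may still be large.\<close>
    define M where "M = (\<Sum>k\<le>N + 2. \<bar>u k\<bar>)"
    have "\<bar>u n\<bar> \<le> \<epsilon> * real n + M" if "1 \<le> n" for n
      using that
    proof (induction n rule: less_induct)
      case (less n)
      show ?case
      proof (cases "n \<le> N + 2")
        case True
        then have "\<bar>u n\<bar> \<le> M" unfolding M_def by (intro member_le_sum) auto
        then show ?thesis using \<epsilon> by (simp add: add_increasing)
      next
        case False
        then have n: "2 \<le> n" "N \<le> n" by auto
        have "\<bar>\<Sum>k\<in>{1..<n}. p n k * u k\<bar> \<le> (\<Sum>k\<in>{1..<n}. p n k * \<bar>u k\<bar>)"
          using p(1) by (intro order_trans[OF sum_abs]) (simp add: abs_mult)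
        also have "\<dots> \<le> (\<Sum>k\<in>{1..<n}. p n k * (\<epsilon> * (real n - 1) + M))"
        proof (intro sum_mono mult_left_mono p(1))
          fix k assume k: "k \<in> {1..<n}"
          then have "\<bar>u k\<bar> \<le> \<epsilon> * real k + M" using less.IH by auto
          also have "\<dots> \<le> \<epsilon> * (real n - 1) + M"
            using k \<epsilon> by (intro add_right_mono mult_left_mono) auto
          finally show "\<bar>u k\<bar> \<le> \<epsilon> * (real n - 1) + M" .
        qed
        also have "\<dots> = \<epsilon> * (real n - 1) + M"
          using p(2)[OF n(1)] by (simp add: sum_distrib_right[symmetric])
        finally show ?thesis
          using u[OF n(1)] N[OF n(2)] by (simp add: algebra_simps)
      qed
    qed
    then show ?thesis by blast
  qed
  have "(\<lambda>n. u n / real n) \<longlonglongrightarrow> 0"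
  proof (rule LIMSEQ_I)
    fix r :: real assume r: "0 < r"
    obtain M where M: "\<And>n. 1 \<le> n \<Longrightarrow> \<bar>u n\<bar> \<le> r / 2 * real n + M"
      using bound[of "r / 2"] r by auto
    obtain N :: nat where N: "2 * \<bar>M\<bar> / r < real N" using reals_Archimedean2 by blast
    have "norm (u n / real n - 0) < r" if n: "Suc N \<le> n" for n
    proof -
      have "2 * \<bar>M\<bar> / r < real n" using N n by simp
      then have "2 * \<bar>M\<bar> < r * real n" using r by (simp add: field_simps)
      then have "\<bar>u n\<bar> < r * real n" using M[of n] n by auto
      then show ?thesis using n by (simp add: abs_divide field_simps)
    qed
    then show "\<exists>N. \<forall>n\<ge>N. norm (u n / real n - 0) < r" by blast
  qed
  then have "(\<lambda>n. u n / real n + 1 / \<mu>) \<longlonglongrightarrow> 0 + 1 / \<mu>"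
    by (intro tendsto_intros)
  moreover have "\<forall>\<^sub>F n in sequentially. u n / real n + 1 / \<mu> = F n / real n"
    using eventually_gt_at_top[of 0] by eventually_elim (simp add: u_def field_simps)
  ultimately show ?thesis by (simp add: Lim_transform_eventually)
qed

section \<open>Binomial coefficients and sums over component sizes\<close>

lemma binomial_products:
  "real (n choose 2) = real n * (real n - 1) / 2"
  "real (n choose 3) = real n * (real n - 1) * (real n - 2) / 6"
  "real (n choose 4) = real n * (real n - 1) * (real n - 2) * (real n - 3) / 24"
  by (simp_all add: binomial_gbinomial gbinomial_prod_rev numeral_eq_Suc atLeast0_lessThan_Suc)

lemma binomial_middle:
  assumes "4 \<le> k" "k + 4 \<le> n"
  shows "n choose 4 \<le> n choose k"
proof (cases "2 * k \<le> n")
  case True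
  then show ?thesis using assms by (intro binomial_mono) auto
next
  case False
  then have "n choose 4 \<le> n choose (n - k)" using assms by (intro binomial_mono) auto
  then show ?thesis using assms by (simp add: binomial_symmetric[symmetric])
qed

text \<open>The cut at 4 is chosen for \<open>middle_weight\<close>: about n terms of order n^2 / (n
  choose 4) still sum to O(1/n), whereas a cut at 3 would leave O(1).\<close>

lemma sum_split_ends:
  fixes f :: "nat \<Rightarrow> real"
  assumes "8 \<le> n"
  shows "(\<Sum>k\<in>{2..n - 2}. f k) = f 2 + f 3 + f (n - 3) + f (n - 2) + (\<Sum>k\<in>{4..n - 4}. f k)"
proof -
  have "{2..n - 2} = insert 2 (insert 3 (insert (n - 3) (insert (n - 2) {4..n - 4})))"
    using assms by auto
  moreover have "2 \<notin> insert 3 (insert (n - 3) (insert (n - 2) {4..n - 4}))"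
    "3 \<notin> insert (n - 3) (insert (n - 2) {4..n - 4})"
    "n - 3 \<notin> insert (n - 2) {4..n - 4}" "n - 2 \<notin> {4..n - 4}"
    using assms by auto
  ultimately show ?thesis by (simp add: add.assoc)
qed

lemma sum_reverse:
  fixes f :: "nat \<Rightarrow> real"
  shows "(\<Sum>k\<in>{1..<n}. f (n - k)) = (\<Sum>k\<in>{1..<n}. f k)"
  by (rule sum.reindex_bij_witness[of _ "\<lambda>k. n - k" "\<lambda>k. n - k"]) auto

section \<open>Recurrences and bounds for the number of connected diagrams\<close>

lemma diagram_count_pos: "1 \<le> n \<Longrightarrow> 0 < diagram_count n"
proof (induction n rule: less_induct)
  case (less n)
  show ?case
  proof (cases "n = 1")
    case False
    then have "1 \<in> {1..<n}" using less.prems by auto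
    moreover have "0 < (2 * 1 - 1) * (diagram_count 1 * diagram_count (n - 1))"
      using less False by simp
    ultimately have "0 < (\<Sum>k\<in>{1..<n}. (2 * k - 1) * (diagram_count k * diagram_count (n - k)))"
      by (intro sum_pos2[of _ 1]) auto
    then show ?thesis using False less.prems by (subst diagram_count.simps) auto
  qed (simp add: diagram_count.simps)
qed

lemma diagram_count_weighted:
  assumes "2 \<le> n"
  shows "real (diagram_count n) =
    (\<Sum>k\<in>{1..<n}. (2 * real k - 1) * (real (diagram_count k) * real (diagram_count (n - k))))"
proof -
  have "real (diagram_count n) =
      (\<Sum>k\<in>{1..<n}. real (2 * k - 1) * (real (diagram_count k) * real (diagram_count (n - k))))"
    using assms by (subst diagram_count.simps) simp
  also have "\<dots> = (\<Sum>k\<in>{1..<n}. (2 * real k - 1) * (real (diagram_count k) * real (diagram_count (n - k))))"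
    by (intro sum.cong refl) (simp add: of_nat_diff)
  finally show ?thesis .
qed

lemma index_total_weighted:
  assumes "2 \<le> n"
  shows "real (index_total n) = real (diagram_count n) +
    (\<Sum>k\<in>{1..<n}. (2 * real k - 1) * (real (index_total k) * real (diagram_count (n - k))))"
proof -
  have "real (index_total n) = real (diagram_count n) +
      (\<Sum>k\<in>{1..<n}. real (2 * k - 1) * (real (index_total k) * real (diagram_count (n - k))))"
    using assms by (subst index_total.simps) simp
  also have "\<dots> = real (diagram_count n) +
      (\<Sum>k\<in>{1..<n}. (2 * real k - 1) * (real (index_total k) * real (diagram_count (n - k))))"
    by (intro arg_cong2[of _ _ _ _ "(+)"] sum.cong refl) (simp add: of_nat_diff)
  finally show ?thesis .
qed

text \<open>The product \<open>c k * c (n - k)\<close> is invariant under k <-> n - k, so a weight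
  may be averaged with its mirror image. This turns 2k - 1 into n - 1, and (2k - 1)(n - k) into 2k(n
  - k) - n/2.\<close>

lemma sum_symmetrize:
  fixes w c :: "nat \<Rightarrow> real"
  shows "(\<Sum>k\<in>{1..<n}. w k * (c k * c (n - k))) =
    (\<Sum>k\<in>{1..<n}. (w k + w (n - k)) / 2 * (c k * c (n - k)))"
proof -
  have "(\<Sum>k\<in>{1..<n}. w k * (c k * c (n - k))) =
      (\<Sum>k\<in>{1..<n}. w (n - k) * (c (n - k) * c (n - (n - k))))"
    by (rule sum_reverse[symmetric])
  also have "\<dots> = (\<Sum>k\<in>{1..<n}. w (n - k) * (c k * c (n - k)))"
    by (intro sum.cong refl) (auto simp: mult.commute)
  finally show ?thesis
    by (simp add: add_divide_distrib distrib_right sum.distrib sum_divide_distrib[symmetric])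
qed

lemma sum_ends:
  fixes f :: "nat \<Rightarrow> real"
  assumes "3 \<le> n"
  shows "(\<Sum>k\<in>{1..<n}. f k) = f 1 + f (n - 1) + (\<Sum>k\<in>{2..n - 2}. f k)"
proof -
  have "{1..<n} = insert 1 (insert (n - 1) {2..n - 2})" using assms by auto
  moreover have "1 \<notin> insert (n - 1) {2..n - 2}" "n - 1 \<notin> {2..n - 2}"
    using assms by auto
  ultimately show ?thesis by (simp add: add.assoc)
qed

text \<open>The classical symmetric recurrence for connected chord diagrams. For n >= 3 its two end
  terms are equal and give the main term 2(n - 1) c_(n-1).\<close>

lemma diagram_count_convolution:
  assumes "2 \<le> n"
  shows "real (diagram_count n) =
    (real n - 1) * (\<Sum>k\<in>{1..<n}. real (diagram_count k) * real (diagram_count (n - k)))"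
  unfolding diagram_count_weighted[OF assms] sum_distrib_left
  by (subst sum_symmetrize, intro sum.cong refl) (auto simp: of_nat_diff field_simps)

text \<open>The factorial turns products of counts into quotients by binomial coefficients; 2^n
  matches the main term 2(n - 1) c_(n-1), which leaves the factor (n - 1)/n.\<close>

definition scaled_count :: "nat \<Rightarrow> real" where
  "scaled_count n = real (diagram_count n) / (2 ^ n * fact n)"

lemma scaled_count_nonneg: "0 \<le> scaled_count n"
  by (simp add: scaled_count_def)

lemma scaled_count_1: "scaled_count 1 = 1 / 2"
  by (simp add: scaled_count_def diagram_count.simps)

lemma diagram_count_product:
  assumes "k \<le> n"
  shows "real (diagram_count k) * real (diagram_count (n - k)) =
    2 ^ n * fact n * (scaled_count k * scaled_count (n - k) / real (n choose k))"
proof -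
  have "(2::real) ^ n = 2 ^ k * 2 ^ (n - k)"
    using assms by (simp add: power_add[symmetric])
  moreover have "real (n choose k) = fact n / (fact k * fact (n - k))"
    by (rule binomial_fact[OF assms])
  ultimately show ?thesis by (simp add: scaled_count_def field_simps)
qed

lemma scaled_count_rec:
  assumes "3 \<le> n"
  shows "scaled_count n = (real n - 1) / real n * scaled_count (n - 1) +
    (real n - 1) * (\<Sum>k\<in>{2..n - 2}. scaled_count k * scaled_count (n - k) / real (n choose k))"
proof -
  let ?t = "\<lambda>k. scaled_count k * scaled_count (n - k) / real (n choose k)"
  have "real (diagram_count n) = (real n - 1) * (\<Sum>k\<in>{1..<n}. 2 ^ n * fact n * ?t k)"
    using assms diagram_count_convolution[of n] by (simp add: diagram_count_product)
  then have "scaled_count n = (real n - 1) * (\<Sum>k\<in>{1..<n}. ?t k)"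
    unfolding scaled_count_def[of n] sum_distrib_left[symmetric] by simp
  also have "(\<Sum>k\<in>{1..<n}. ?t k) = ?t 1 + ?t (n - 1) + (\<Sum>k\<in>{2..n - 2}. ?t k)"
    using assms by (rule sum_ends)
  also have "?t (n - 1) = ?t 1"
    using assms binomial_symmetric[of 1 n] by simp
  also have "?t 1 = scaled_count (n - 1) / (2 * real n)"
    unfolding scaled_count_1 by simp
  finally show ?thesis using assms by (simp add: field_simps)
qed

text \<open>The left side is about 4/n for large n, from k = 2 and k = n - 2. The constant 8 is the
  most that the induction in \<open>scaled_count_le\<close> can afford.\<close>

lemma sum_inverse_binomial_le:
  assumes "3 \<le> n"
  shows "(real n - 1) * (\<Sum>k\<in>{2..n - 2}. 1 / real (n choose k)) \<le> 8 / real n"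
proof (cases "8 \<le> n")
  case True
  have sym: "n choose (n - 2) = n choose 2" "n choose (n - 3) = n choose 3"
    using True by (simp_all add: binomial_symmetric[symmetric])
  have "(\<Sum>k\<in>{4..n - 4}. 1 / real (n choose k)) \<le> (\<Sum>k\<in>{4..n - 4}. 1 / real (n choose 4))"
    using True binomial_middle[of _ n] by (intro sum_mono divide_left_mono) auto
  also have "\<dots> = (real n - 7) / real (n choose 4)"
    using True by (simp add: of_nat_diff)
  finally have "(\<Sum>k\<in>{2..n - 2}. 1 / real (n choose k)) \<le>
      2 / real (n choose 2) + 2 / real (n choose 3) + (real n - 7) / real (n choose 4)"
    using True by (simp add: sum_split_ends sym)
  then have "(real n - 1) * (\<Sum>k\<in>{2..n - 2}. 1 / real (n choose k)) \<le>
      (real n - 1) * (2 / real (n choose 2) + 2 / real (n choose 3) + (real n - 7) / real (n choose 4))"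
    using True by (intro mult_left_mono) auto
  also have "\<dots> \<le> 8 / real n"
  proof -
    define x where "x = real n - 8"
    have n: "real n = x + 8" and x: "0 \<le> x" using True by (auto simp: x_def)
    have "(real n - 1) * (2 / real (n choose 2) + 2 / real (n choose 3) + (real n - 7) / real (n choose 4))
      = (4 + 12 / (x + 6) + 24 * (x + 1) / ((x + 6) * (x + 5))) / (x + 8)"
      unfolding binomial_products n using x by (simp add: divide_simps) algebra
    also have "\<dots> \<le> 8 / (x + 8)"
    proof (intro divide_right_mono)
      have "12 / (x + 6) \<le> 2" using x by (simp add: divide_simps)
      moreover have "24 * (x + 1) / ((x + 6) * (x + 5)) \<le> 2"
      proof -
        \<comment> \<open>The difference of the two sides below is twice (x - 1)^2 + x + 17.\<close>
        have "0 \<le> (x - 1) ^ 2" by simp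
        then have "24 * (x + 1) \<le> 2 * ((x + 6) * (x + 5))"
          using x by (simp add: power2_eq_square algebra_simps)
        then show ?thesis using x by (simp add: divide_simps)
      qed
      ultimately show "4 + 12 / (x + 6) + 24 * (x + 1) / ((x + 6) * (x + 5)) \<le> 8" by simp
    qed (use x in auto)
    finally show ?thesis by (simp add: n)
  qed
  finally show ?thesis .
next
  case False
  with assms consider "n = 3" | "n = 4" | "n = 5" | "n = 6" | "n = 7" by linarith
  then show ?thesis
    by cases (simp_all add: numeral_eq_Suc atLeastAtMostSuc_conv)
qed

text \<open>1/8 is the value at n = 2, and the induction closes exactly: the factor (n - 1)/n loses
  1/(8n), and the middle sum adds at most 1/64 times 8/n.\<close>

lemma scaled_count_le: "2 \<le> n \<Longrightarrow> scaled_count n \<le> 1 / 8"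
proof (induction n rule: less_induct)
  case (less n)
  show ?case
  proof (cases "n = 2")
    case True
    have "diagram_count 2 = 1"
      by (subst diagram_count.simps) (simp add: numeral_eq_Suc diagram_count.simps[of "Suc 0"])
    then show ?thesis using True by (simp add: scaled_count_def)
  next
    case False
    with less.prems have n: "3 \<le> n" by simp
    have "(\<Sum>k\<in>{2..n - 2}. scaled_count k * scaled_count (n - k) / real (n choose k)) \<le>
        (\<Sum>k\<in>{2..n - 2}. 1 / 64 * (1 / real (n choose k)))"
    proof (intro sum_mono)
      fix k assume k: "k \<in> {2..n - 2}"
      then have "scaled_count k * scaled_count (n - k) \<le> 1 / 8 * (1 / 8)"
        using n by (intro mult_mono less.IH scaled_count_nonneg) auto
      then have "scaled_count k * scaled_count (n - k) / real (n choose k) \<le> 1 / 8 * (1 / 8) / real (n choose k)"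
        by (intro divide_right_mono) auto
      then show "scaled_count k * scaled_count (n - k) / real (n choose k) \<le> 1 / 64 * (1 / real (n choose k))"
        by simp
    qed
    also have "\<dots> = 1 / 64 * (\<Sum>k\<in>{2..n - 2}. 1 / real (n choose k))"
      by (simp only: sum_distrib_left)
    finally have "(real n - 1) * (\<Sum>k\<in>{2..n - 2}. scaled_count k * scaled_count (n - k) / real (n choose k))
      \<le> (real n - 1) * (1 / 64 * (\<Sum>k\<in>{2..n - 2}. 1 / real (n choose k)))"
      using n by (intro mult_left_mono) auto
    also have "\<dots> \<le> 1 / 64 * (8 / real n)"
      using sum_inverse_binomial_le[OF n] by simp
    finally have "(real n - 1) * (\<Sum>k\<in>{2..n - 2}. scaled_count k * scaled_count (n - k) / real (n choose k))
      \<le> 1 / (8 * real n)" by simp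
    moreover have "(real n - 1) / real n * scaled_count (n - 1) \<le> (real n - 1) / real n * (1 / 8)"
      using n less.IH[of "n - 1"] by (intro mult_left_mono) auto
    ultimately have "scaled_count n \<le> (real n - 1) / real n * (1 / 8) + 1 / (8 * real n)"
      unfolding scaled_count_rec[OF n] by linarith
    also have "\<dots> = 1 / 8" using n by (simp add: field_simps)
    finally show ?thesis .
  qed
qed

text \<open>The recursion without its nonnegative middle sum; for consecutive arguments this reads
  c_n >= 2(n - 1) c_(n-1).\<close>

lemma scaled_count_mono:
  assumes "2 \<le> m" "m \<le> n"
  shows "real m * scaled_count m \<le> real n * scaled_count n"
  using assms(2)
proof (induction n rule: dec_induct)
  case (step j)
  have j: "3 \<le> Suc j" using step assms by simp
  have "0 \<le> (\<Sum>k\<in>{2..Suc j - 2}. scaled_count k * scaled_count (Suc j - k) / real (Suc j choose k))"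
    by (intro sum_nonneg divide_nonneg_nonneg mult_nonneg_nonneg scaled_count_nonneg) auto
  then have "real j / real (Suc j) * scaled_count j \<le> scaled_count (Suc j)"
    using scaled_count_rec[OF j] by simp
  then have "real j * scaled_count j \<le> real (Suc j) * scaled_count (Suc j)"
    by (simp add: field_simps del: of_nat_Suc)
  then show ?case using step by linarith
qed simp

text \<open>The share of the sizes other than 1 and n - 1. The weight k(n - k) dominates n - 1, the
  weight in the recurrence, and its double dominates 2k(n - k) - n/2, the weight in the expected
  drop.\<close>

definition middle_weight :: "nat \<Rightarrow> real" where
  "middle_weight n = (\<Sum>k\<in>{2..n - 2}. real k * (real n - real k) *
     (real (diagram_count k) * real (diagram_count (n - k))) / real (diagram_count n))"

text \<open>\<open>scaled_count k\<close> is at most 1/8, while n - k times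
  \<open>scaled_count (n - k)\<close> is at most n times \<open>scaled_count n\<close>, which
  cancels the denominator.\<close>

lemma middle_weight_term_le:
  assumes "2 \<le> k" "k + 2 \<le> n"
  shows "real k * (real n - real k) * (real (diagram_count k) * real (diagram_count (n - k))) /
    real (diagram_count n) \<le> real k * real n / (8 * real (n choose k))"
proof -
  have e: "0 < scaled_count n"
    using diagram_count_pos[of n] assms by (simp add: scaled_count_def)
  have C: "0 < real (n choose k)" using assms by simp
  have c: "real (diagram_count n) = 2 ^ n * fact n * scaled_count n"
    by (simp add: scaled_count_def)
  have "real k * (real n - real k) * (real (diagram_count k) * real (diagram_count (n - k))) /
      real (diagram_count n) =
      scaled_count k * (real (n - k) * scaled_count (n - k)) * real k / (scaled_count n * real (n choose k))"
    unfolding c using assms e by (subst diagram_count_product) (auto simp: of_nat_diff field_simps)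
  also have "\<dots> \<le> 1 / 8 * (real n * scaled_count n) * real k / (scaled_count n * real (n choose k))"
    using assms e C
    by (intro divide_right_mono mult_right_mono mult_mono scaled_count_le scaled_count_mono
        mult_nonneg_nonneg scaled_count_nonneg) auto
  also have "\<dots> = real k * real n / (8 * real (n choose k))"
    using e C by (simp add: field_simps)
  finally show ?thesis .
qed

lemma middle_weight_nonneg: "0 \<le> middle_weight n"
  unfolding middle_weight_def by (intro sum_nonneg) auto

lemma middle_weight_tendsto: "middle_weight \<longlonglongrightarrow> 0"
proof (rule tendsto_sandwich)
  let ?b = "\<lambda>n. 2 * (2 * real n / (8 * (real n * (real n - 1) / 2))) +
      2 * (3 * real n / (8 * (real n * (real n - 1) * (real n - 2) / 6))) +
      real n ^ 3 / (8 * (real n * (real n - 1) * (real n - 2) * (real n - 3) / 24))"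
  show "(\<lambda>_. 0 :: real) \<longlonglongrightarrow> 0" by simp
  show "?b \<longlonglongrightarrow> 0" by real_asymp
  show "\<forall>\<^sub>F n in sequentially. middle_weight n \<le> ?b n"
    using eventually_ge_at_top[of 8]
  proof eventually_elim
    case (elim n)
    define f where "f k = real k * (real n - real k) *
      (real (diagram_count k) * real (diagram_count (n - k))) / real (diagram_count n)" for k
    \<comment> \<open>The bound \<open>le\<close> carries the factor k and does not vanish at k = n
      - 2, so the right end is reflected to the left one.\<close>
    have sym: "f (n - k) = f k" if "k \<le> n" for k
      using that by (simp add: f_def of_nat_diff mult_ac)
    have le: "f k \<le> real k * real n / (8 * real (n choose k))" if "2 \<le> k" "k + 2 \<le> n" for k
      unfolding f_def using that by (rule middle_weight_term_le)
    have "(\<Sum>k\<in>{4..n - 4}. f k) \<le> (\<Sum>k\<in>{4..n - 4}. real n * real n / (8 * real (n choose 4)))"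
    proof (intro sum_mono)
      fix k assume k: "k \<in> {4..n - 4}"
      have "f k \<le> real k * real n / (8 * real (n choose k))" using k elim by (intro le) auto
      also have "\<dots> \<le> real n * real n / (8 * real (n choose 4))"
        using k elim binomial_middle[of k n]
        by (intro frac_le mult_right_mono mult_left_mono mult_nonneg_nonneg) auto
      finally show "f k \<le> real n * real n / (8 * real (n choose 4))" .
    qed
    also have "\<dots> = (real n - 7) * (real n * real n / (8 * real (n choose 4)))"
      using elim by (simp add: of_nat_diff)
    also have "\<dots> \<le> real n * (real n * real n / (8 * real (n choose 4)))"
      by (intro mult_right_mono) auto
    finally have "(\<Sum>k\<in>{4..n - 4}. f k) \<le> real n ^ 3 / (8 * real (n choose 4))"
      by (simp add: power3_eq_cube mult_ac)
    moreover have "f 2 \<le> 2 * real n / (8 * real (n choose 2))" "f 3 \<le> 3 * real n / (8 * real (n choose 3))"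
      using le[of 2] le[of 3] elim by simp_all
    moreover have "middle_weight n = (\<Sum>k\<in>{2..n - 2}. f k)"
      by (simp add: middle_weight_def f_def)
    then have "middle_weight n = 2 * f 2 + 2 * f 3 + (\<Sum>k\<in>{4..n - 4}. f k)"
      using sum_split_ends[OF elim, of f] sym[of 2] sym[of 3] elim by simp
    ultimately show ?case unfolding binomial_products by linarith
  qed
qed (auto simp: middle_weight_nonneg)

text \<open>Divided by c_n, the recurrence splits 1 into this ratio, from k = 1 and k = n - 1, and a
  remainder between 0 and \<open>middle_weight n\<close>.\<close>

lemma diagram_count_ratio_tendsto:
  "(\<lambda>n. 2 * (real n - 1) * real (diagram_count (n - 1)) / real (diagram_count n)) \<longlonglongrightarrow> 1"
proof (rule tendsto_sandwich)
  have "(\<lambda>n. 1 - middle_weight n) \<longlonglongrightarrow> 1 - 0"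
    by (intro tendsto_intros middle_weight_tendsto)
  then show "(\<lambda>n. 1 - middle_weight n) \<longlonglongrightarrow> 1" by simp
  have split: "1 = 2 * (real n - 1) * real (diagram_count (n - 1)) / real (diagram_count n) +
      (\<Sum>k\<in>{2..n - 2}. (real n - 1) * (real (diagram_count k) * real (diagram_count (n - k))) /
        real (diagram_count n))"
    if n: "3 \<le> n" for n
  proof -
    have c: "0 < real (diagram_count n)" using diagram_count_pos[of n] n by simp
    have "diagram_count 1 = 1" by (simp add: diagram_count.simps)
    then have "(\<Sum>k\<in>{1..<n}. real (diagram_count k) * real (diagram_count (n - k))) =
        2 * real (diagram_count (n - 1)) +
        (\<Sum>k\<in>{2..n - 2}. real (diagram_count k) * real (diagram_count (n - k)))"
      using n by (subst sum_ends) auto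
    then have "real (diagram_count n) = 2 * (real n - 1) * real (diagram_count (n - 1)) +
        (real n - 1) * (\<Sum>k\<in>{2..n - 2}. real (diagram_count k) * real (diagram_count (n - k)))"
      using n by (subst diagram_count_convolution) (auto simp: algebra_simps)
    then have "real (diagram_count n) / real (diagram_count n) =
        (2 * (real n - 1) * real (diagram_count (n - 1)) +
        (real n - 1) * (\<Sum>k\<in>{2..n - 2}. real (diagram_count k) * real (diagram_count (n - k)))) /
        real (diagram_count n)"
      by simp
    then show ?thesis
      using c by (simp add: add_divide_distrib sum_distrib_left sum_divide_distrib)
  qed
  show "\<forall>\<^sub>F n in sequentially. 2 * (real n - 1) * real (diagram_count (n - 1)) / real (diagram_count n) \<le> 1"
    using eventually_ge_at_top[of 3]
  proof eventually_elim
    case (elim n)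
    have "0 \<le> (\<Sum>k\<in>{2..n - 2}. (real n - 1) *
        (real (diagram_count k) * real (diagram_count (n - k))) / real (diagram_count n))"
      using elim by (intro sum_nonneg) auto
    then show ?case using split[OF elim] by linarith
  qed
  show "\<forall>\<^sub>F n in sequentially. 1 - middle_weight n \<le>
      2 * (real n - 1) * real (diagram_count (n - 1)) / real (diagram_count n)"
    using eventually_ge_at_top[of 3]
  proof eventually_elim
    case (elim n)
    have "(\<Sum>k\<in>{2..n - 2}. (real n - 1) *
        (real (diagram_count k) * real (diagram_count (n - k))) / real (diagram_count n)) \<le> middle_weight n"
      unfolding middle_weight_def
    proof (intro sum_mono divide_right_mono mult_right_mono)
      fix k assume k: "k \<in> {2..n - 2}"
      \<comment> \<open>The product expands to k(n - k) - (n - 1).\<close>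
      then have "0 \<le> (real k - 1) * (real n - real k - 1)"
        using elim by (intro mult_nonneg_nonneg) auto
      then show "real n - 1 \<le> real k * (real n - real k)" by (simp add: algebra_simps)
    qed auto
    then show ?case using split[OF elim] by linarith
  qed
qed simp

text \<open>The probability that the first component of a uniformly random connected diagram with n
  chords has k chords.\<close>

definition component_size_prob :: "nat \<Rightarrow> nat \<Rightarrow> real" where
  "component_size_prob n k =
     real (2 * k - 1) * (real (diagram_count k) * real (diagram_count (n - k))) / real (diagram_count n)"

text \<open>After symmetrization the weight at k = 1 and at k = n - 1 is (3n - 4)/2. Both ends
  together give (3n - 4) c_(n-1) / c_n, which tends to 3/2 because 2(n - 1) c_(n-1) / c_n tends to
  1. The rest is squeezed between 0 and twice \<open>middle_weight\<close>.\<close>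

lemma expected_size_drop:
  "(\<lambda>n. \<Sum>k\<in>{1..<n}. component_size_prob n k * (real n - real k)) \<longlonglongrightarrow> 3 / 2"
proof -
  define \<rho> where "\<rho> n = 2 * (real n - 1) * real (diagram_count (n - 1)) / real (diagram_count n)" for n
  define w where "w n = (\<Sum>k\<in>{2..n - 2}. (2 * real k * (real n - real k) - real n / 2) *
     (real (diagram_count k) * real (diagram_count (n - k))) / real (diagram_count n))" for n
  have w: "w \<longlonglongrightarrow> 0"
  proof (rule tendsto_sandwich)
    show "(\<lambda>_. 0 :: real) \<longlonglongrightarrow> 0" by simp
    have "(\<lambda>n. 2 * middle_weight n) \<longlonglongrightarrow> 2 * 0"
      by (intro tendsto_intros middle_weight_tendsto)
    then show "(\<lambda>n. 2 * middle_weight n) \<longlonglongrightarrow> 0" by simp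
    show "\<forall>\<^sub>F n in sequentially. w n \<le> 2 * middle_weight n"
    proof (intro always_eventually allI)
      fix n
      have "w n \<le> (\<Sum>k\<in>{2..n - 2}. (2 * (real k * (real n - real k))) *
         (real (diagram_count k) * real (diagram_count (n - k))) / real (diagram_count n))"
        unfolding w_def by (intro sum_mono divide_right_mono mult_right_mono) auto
      also have "\<dots> = 2 * middle_weight n"
        by (simp add: middle_weight_def sum_distrib_left mult.assoc)
      finally show "w n \<le> 2 * middle_weight n" .
    qed
    show "\<forall>\<^sub>F n in sequentially. 0 \<le> w n"
    proof (intro always_eventually allI)
      fix n
      show "0 \<le> w n"
        unfolding w_def
      proof (intro sum_nonneg divide_nonneg_nonneg mult_nonneg_nonneg)
        fix k assume k: "k \<in> {2..n - 2}"
        \<comment> \<open>This yields 2k(n - k) >= 2(n - 1), which exceeds n/2.\<close>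
        then have "0 \<le> (real k - 1) * (real n - real k - 1)"
          by (intro mult_nonneg_nonneg) auto
        moreover have "4 \<le> real n" using k by auto
        ultimately show "0 \<le> 2 * real k * (real n - real k) - real n / 2"
          by (simp add: algebra_simps)
      qed auto
    qed
  qed
  have "(\<lambda>n. (3 * real n - 4) / (2 * (real n - 1))) \<longlonglongrightarrow> 3 / 2" by real_asymp
  then have "(\<lambda>n. (3 * real n - 4) / (2 * (real n - 1)) * \<rho> n + w n) \<longlonglongrightarrow> 3 / 2 * 1 + 0"
    unfolding \<rho>_def by (intro tendsto_add tendsto_mult w diagram_count_ratio_tendsto)
  moreover have "\<forall>\<^sub>F n in sequentially. (3 * real n - 4) / (2 * (real n - 1)) * \<rho> n + w n =
      (\<Sum>k\<in>{1..<n}. component_size_prob n k * (real n - real k))"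
    using eventually_ge_at_top[of 3]
  proof eventually_elim
    case (elim n)
    let ?c = "\<lambda>k. real (diagram_count k)"
    have "(\<Sum>k\<in>{1..<n}. component_size_prob n k * (real n - real k)) =
        (\<Sum>k\<in>{1..<n}. (2 * real k - 1) * (real n - real k) * (?c k * ?c (n - k))) / ?c n"
      unfolding sum_divide_distrib
      by (intro sum.cong refl) (simp add: component_size_prob_def of_nat_diff)
    also have "(\<Sum>k\<in>{1..<n}. (2 * real k - 1) * (real n - real k) * (?c k * ?c (n - k))) =
        (\<Sum>k\<in>{1..<n}. (2 * real k * (real n - real k) - real n / 2) * (?c k * ?c (n - k)))"
      by (subst sum_symmetrize, intro sum.cong refl) (auto simp: of_nat_diff field_simps)
    also have "\<dots> / ?c n = (3 * real n - 4) * ?c (n - 1) / ?c n + w n"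
    proof -
      define t where "t k = (2 * real k * (real n - real k) - real n / 2) * (?c k * ?c (n - k))" for k
      have "?c 1 = 1" by (simp add: diagram_count.simps)
      then have "t 1 = (3 * real n - 4) / 2 * ?c (n - 1)" "t (n - 1) = (3 * real n - 4) / 2 * ?c (n - 1)"
        using elim by (simp_all add: t_def of_nat_diff algebra_simps)
      then have "(\<Sum>k\<in>{1..<n}. t k) = (3 * real n - 4) * ?c (n - 1) + (\<Sum>k\<in>{2..n - 2}. t k)"
        using sum_ends[OF elim, of t] by (simp add: field_simps)
      then show ?thesis
        by (simp only: t_def w_def sum_divide_distrib[symmetric] add_divide_distrib)
    qed
    also have "(3 * real n - 4) * ?c (n - 1) / ?c n = (3 * real n - 4) / (2 * (real n - 1)) * \<rho> n"
      using elim diagram_count_pos[of n] by (simp add: \<rho>_def divide_simps)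
    finally show ?case by simp
  qed
  ultimately show ?thesis by (simp add: Lim_transform_eventually)
qed

lemma mean_index_tendsto:
  "(\<lambda>n. real (index_total n) / real (diagram_count n) / real n) \<longlonglongrightarrow> 2 / 3"
proof -
  have "(\<lambda>n. real (index_total n) / real (diagram_count n) / real n) \<longlonglongrightarrow> 1 / (3 / 2)"
  proof (rule linear_recursion_limit[OF _ _ _ expected_size_drop])
    show "0 \<le> component_size_prob n k" for n k
      by (simp add: component_size_prob_def)
    fix n :: nat assume n: "2 \<le> n"
    have c: "0 < real (diagram_count m)" if "1 \<le> m" for m
      using diagram_count_pos[OF that] by simp
    have "(\<Sum>k\<in>{1..<n}. component_size_prob n k) =
        (\<Sum>k\<in>{1..<n}. (2 * real k - 1) * (real (diagram_count k) * real (diagram_count (n - k)))) /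
        real (diagram_count n)"
      unfolding sum_divide_distrib
      by (intro sum.cong refl) (simp add: component_size_prob_def of_nat_diff)
    then show "(\<Sum>k\<in>{1..<n}. component_size_prob n k) = 1"
      using diagram_count_weighted[OF n] c[of n] n by simp
    have "(\<Sum>k\<in>{1..<n}. component_size_prob n k * (real (index_total k) / real (diagram_count k))) =
        (\<Sum>k\<in>{1..<n}. (2 * real k - 1) * (real (index_total k) * real (diagram_count (n - k)))) /
        real (diagram_count n)"
      unfolding sum_divide_distrib
    proof (intro sum.cong refl)
      fix k assume "k \<in> {1..<n}"
      then show "component_size_prob n k * (real (index_total k) / real (diagram_count k)) =
          (2 * real k - 1) * (real (index_total k) * real (diagram_count (n - k))) / real (diagram_count n)"
        using c[of k] c[of n] by (simp add: component_size_prob_def of_nat_diff field_simps)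
    qed
    then show "real (index_total n) / real (diagram_count n) =
        1 + (\<Sum>k\<in>{1..<n}. component_size_prob n k * (real (index_total k) / real (diagram_count k)))"
      using index_total_weighted[OF n] c[of n] n by (simp add: field_simps)
  qed simp
  then show ?thesis by simp
qed

theorem theorem4p8:
  shows "(\<lambda>n. measure_pmf.expectation (pmf_of_set (connected_chord_diagrams n))
                (\<lambda>C. real (first_terminal_index C)))
         \<sim>[at_top] (\<lambda>n. 2 * real n / 3)"
proof (rule asymp_equivI')
  \<comment> \<open>For n = 0 there is no connected diagram and \<open>pmf_of_set\<close> meets the
    empty set; the limit concerns n >= 1 only.\<close>
  have eq: "measure_pmf.expectation (pmf_of_set (connected_chord_diagrams n))
      (\<lambda>C. real (first_terminal_index C)) = real (index_total n) / real (diagram_count n)"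
    if n: "1 \<le> n" for n
  proof -
    have stats: "card (connected_chord_diagrams n) = diagram_count n"
        "(\<Sum>C\<in>connected_chord_diagrams n. first_terminal_index C) = index_total n"
      using connected_diagrams_on_statistics[of "{1..2 * n}" n] n
      by (simp_all add: connected_chord_diagrams_eq)
    then have "card (connected_chord_diagrams n) > 0" using diagram_count_pos[OF n] by simp
    then have "finite (connected_chord_diagrams n)" "connected_chord_diagrams n \<noteq> {}"
      by (auto simp: card_gt_0_iff)
    then have "measure_pmf.expectation (pmf_of_set (connected_chord_diagrams n))
        (\<lambda>C. real (first_terminal_index C)) =
        (\<Sum>C\<in>connected_chord_diagrams n. real (first_terminal_index C)) /
        real (card (connected_chord_diagrams n))"
      by (simp add: integral_pmf_of_set)
    then show ?thesis using stats by (simp add: of_nat_sum[symmetric])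
  qed
  have "(\<lambda>n. real (index_total n) / real (diagram_count n) / real n * (3 / 2)) \<longlonglongrightarrow> 2 / 3 * (3 / 2)"
    by (intro tendsto_intros mean_index_tendsto)
  moreover have "\<forall>\<^sub>F n in sequentially. real (index_total n) / real (diagram_count n) / real n * (3 / 2) =
      measure_pmf.expectation (pmf_of_set (connected_chord_diagrams n))
        (\<lambda>C. real (first_terminal_index C)) / (2 * real n / 3)"
    using eventually_ge_at_top[of 1] by eventually_elim (simp add: eq)
  ultimately show "(\<lambda>n. measure_pmf.expectation (pmf_of_set (connected_chord_diagrams n))
        (\<lambda>C. real (first_terminal_index C)) / (2 * real n / 3)) \<longlonglongrightarrow> 1"
    by (simp add: Lim_transform_eventually)
qed

end
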